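(* Let $n\ge 0$ and $t\in\mathbb{F}_2^{n+1}$. The image of $$X_n=x_0,\;x_2-x_3,\;x_4-x_5,\;\ldots,\;x_{2n}-x_{2n+1},\;x_{2n+2}-x_{2n+3},\;x_{2n+4}$$ in $R(n,t)=S(n)/I_{G_n^t}$ is a regular sequence for $R(n,t)$.
   Context: Throughout, $k$ is a field. Ladder-like structures. For $n\ge 0$ and $t=(t_1,\dots,t_{n+1})\in\mathbb{F}_2^{n+1}$, $L_n^t$ is a partially filled array with $\lfloor n/2\rfloor+2$ rows (numbered top to bottom) and $\lceil n/2\rceil+2$ columns (numbered left to right); its nonzero entries are the variables $x_0,x_2,x_3,\dots,x_{2n+4}$ (there is no $x_1$), each occurring exactly once, all other positions being empty. It is defined recursively, with $\widehat t=(t_1,\dots,t_n)$: - $L_0^t$ has first row $x_0,x_2$ and second row $x_3,x_4$ (for both values of $t$). - $L_1^t$ has first row $x_0,x_2,x_5$ and second row $x_3,x_4,x_6$ (for all $t$). - For $n\ge 2$ even, $L_n^t$ is $L_{n-1}^{\widehat t}$ with a new bottom row added whose only nonzero entries are $x_{2n+4}$, in the last column, and $x_{2n+3}$, in the column containing the first (if $t_{n+1}=0$) or the second (if $t_{n+1}=1$) nonzero entry, from left to right, of the row immediately above the new row. - For $n\ge 3$ odd, $L_n^t$ is $L_{n-1}^{\widehat t}$ with a new rightmost column added whose only nonzero entries are $x_{2n+4}$, in the last row, and $x_{2n+3}$, in the row containing the first (if $t_{n+1}=0$) or the second (if $t_{n+1}=1$) nonzero entry, from top to bottom, of the column immediately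 to the left of the new column. Graphs and toric rings. $G_n^t$ is the bipartite graph with one vertex for each row and one vertex for each column of $L_n^t$, and, for each nonzero entry $x_j$ of $L_n^t$, one edge (called $x_j$) joining the vertex of its row to the vertex of its column. Let $V$ be its vertex set, $S(n)=k[x_0,x_2,x_3,\dots,x_{2n+4}]$ the polynomial ring on the edges, and $I_{G_n^t}$ (the toric ideal) the kernel of the $k$-algebra homomorphism $S(n)\to k[V]$ sending each edge to the product of its two endpoints. The toric ring is $R(n,t)=S(n)/I_{G_n^t}$. *)

theory Defs
  imports "HOL-Algebra.QuotRing" "HOL-Library.Poly_Mapping" "HOL-Library.Z2"
begin

section \<open>Polynomial rings and substitution\<close>

text \<open>The exponent vector of a monomial in variables from \<^typ>\<open>'v\<close> is an element of
  \<^typ>\<open>'v \<Rightarrow>\<^sub>0 nat\<close>; the product on \<^typ>\<open>('v \<Rightarrow>\<^sub>0 nat) \<Rightarrow>\<^sub>0 'k\<close> is the convolution product,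
  i.e. multiplication of polynomials.\<close>

type_synonym ('v, 'k) mpol = "('v \<Rightarrow>\<^sub>0 nat) \<Rightarrow>\<^sub>0 'k"

definition mpol_ring :: "'v set \<Rightarrow> ('v, 'k::field) mpol ring" where
  "mpol_ring V = \<lparr> carrier = {p. \<forall>m \<in> Poly_Mapping.keys p. Poly_Mapping.keys m \<subseteq> V},
     mult = (*), one = 1, zero = 0, add = (+) \<rparr>"

definition const :: "'k::field \<Rightarrow> ('v, 'k) mpol" where
  "const a = Poly_Mapping.single 0 a"

definition var :: "'v \<Rightarrow> ('v, 'k::field) mpol" where
  "var v = Poly_Mapping.single (Poly_Mapping.single v 1) 1"

text \<open>The homomorphism of \<^typ>\<open>'k\<close>-algebras determined by \<open>var e \<mapsto> f e\<close>.\<close>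

definition subst_hom :: "('e \<Rightarrow> ('v, 'k::field) mpol) \<Rightarrow> ('e, 'k) mpol \<Rightarrow> ('v, 'k) mpol" where
  "subst_hom f p = (\<Sum>m \<in> Poly_Mapping.keys p. const (Poly_Mapping.lookup p m) *
     (\<Prod>e \<in> Poly_Mapping.keys m. f e ^ Poly_Mapping.lookup m e))"


section \<open>Toric ideals and toric rings of graphs\<close>

record ('v, 'e) graph =
  verts :: "'v set"
  edges :: "'e set"
  ends  :: "'e \<Rightarrow> 'v set"

definition edge_ring :: "('v, 'e) graph \<Rightarrow> ('e, 'k::field) mpol ring" where
  "edge_ring G = mpol_ring (edges G)"

definition vertex_ring :: "('v, 'e) graph \<Rightarrow> ('v, 'k::field) mpol ring" where
  "vertex_ring G = mpol_ring (verts G)"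

definition toric_hom :: "('v, 'e) graph \<Rightarrow> ('e, 'k::field) mpol \<Rightarrow> ('v, 'k) mpol" where
  "toric_hom G = subst_hom (\<lambda>e. \<Prod>v \<in> ends G e. var v)"

definition toric_ideal :: "('v, 'e) graph \<Rightarrow> ('e, 'k::field) mpol set" where
  "toric_ideal G = a_kernel (edge_ring G) (vertex_ring G) (toric_hom G)"

definition toric_ring :: "('v, 'e) graph \<Rightarrow> ('e, 'k::field) mpol set ring" where
  "toric_ring G = edge_ring G Quot toric_ideal G"

definition toric_class :: "('v, 'e) graph \<Rightarrow> ('e, 'k::field) mpol \<Rightarrow> ('e, 'k) mpol set" where
  "toric_class G f = toric_ideal G +>\<^bsub>edge_ring G\<^esub> f"


section \<open>Regular sequences\<close>

definition nonzerodivisor :: "('a, 'm) ring_scheme \<Rightarrow> 'a \<Rightarrow> bool" where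
  "nonzerodivisor R a \<longleftrightarrow> a \<in> carrier R \<and>
     (\<forall>b \<in> carrier R. a \<otimes>\<^bsub>R\<^esub> b = \<zero>\<^bsub>R\<^esub> \<longrightarrow> b = \<zero>\<^bsub>R\<^esub>)"

definition regular_sequence :: "('a, 'm) ring_scheme \<Rightarrow> 'a list \<Rightarrow> bool" where
  "regular_sequence R xs \<longleftrightarrow> set xs \<subseteq> carrier R \<and>
     (\<forall>i < length xs. let J = Idl\<^bsub>R\<^esub> (set (take i xs))
        in nonzerodivisor (R Quot J) (J +>\<^bsub>R\<^esub> (xs ! i))) \<and>
     Idl\<^bsub>R\<^esub> (set xs) \<noteq> carrier R"


section \<open>Ladder-like structures\<close>

definition nrows :: "nat \<Rightarrow> nat" where
  "nrows n = n div 2 + 2"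

definition ncols :: "nat \<Rightarrow> nat" where
  "ncols n = (n + 1) div 2 + 2"

text \<open>The smallest element of \<open>S\<close> if \<open>b = 0\<close>, the second smallest if \<open>b = 1\<close>.\<close>

definition pick :: "bit \<Rightarrow> nat set \<Rightarrow> nat" where
  "pick b S = (if b = 0 then Min S else Min (S - {Min S}))"

text \<open>A partially filled array maps the position (row, column), counted from 1, to the index \<open>j\<close> of
  its entry \<open>x\<^sub>j\<close>, and is undefined at empty positions. The list \<open>t\<close> is \<open>(t\<^sub>1, \<dots>, t\<^sub>n\<^sub>+\<^sub>1)\<close>,
  so that \<^term>\<open>last t\<close> is \<open>t\<^sub>n\<^sub>+\<^sub>1\<close>.\<close>

fun ladder :: "nat \<Rightarrow> bit list \<Rightarrow> (nat \<times> nat \<rightharpoonup> nat)" where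
  "ladder 0 t = [(1,1) \<mapsto> 0, (1,2) \<mapsto> 2,
                 (2,1) \<mapsto> 3, (2,2) \<mapsto> 4]"
| "ladder (Suc 0) t = [(1,1) \<mapsto> 0, (1,2) \<mapsto> 2, (1,3) \<mapsto> 5,
                       (2,1) \<mapsto> 3, (2,2) \<mapsto> 4, (2,3) \<mapsto> 6]"
| "ladder (Suc (Suc m)) t =
     (let n = m + 2; A = ladder (Suc m) (butlast t); r = nrows n; c = ncols n
      in if even n
         then A((r, c) \<mapsto> 2 * n + 4, (r, pick (last t) {j. (r - 1, j) \<in> dom A}) \<mapsto> 2 * n + 3)
         else A((r, c) \<mapsto> 2 * n + 4, (pick (last t) {i. (i, c - 1) \<in> dom A}, c) \<mapsto> 2 * n + 3))"

text \<open>Rows are the vertices \<open>Inl i\<close>, columns the vertices \<open>Inr j\<close>.\<close>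

definition graph_of_ladder :: "nat \<Rightarrow> bit list \<Rightarrow> (nat + nat, nat) graph" where
  "graph_of_ladder n t =
     \<lparr> verts = Inl ` {1..nrows n} \<union> Inr ` {1..ncols n},
       edges = ran (ladder n t),
       ends = (\<lambda>e. {v. \<exists>i j. ladder n t (i, j) = Some e \<and> (v = Inl i \<or> v = Inr j)}) \<rparr>"

definition ladder_seq :: "nat \<Rightarrow> (nat, 'k::field) mpol list" where
  "ladder_seq n =
     [var 0] @ map (\<lambda>i. var (2 * i) - var (2 * i + 1)) [1..<n + 2] @ [var (2 * n + 4)]"

end

theory Submission
  imports Defs Complex_Main "HOL-Library.Multiset"
begin

text \<open>Number the vertices of the graph in the order in which the ladder acquires them: \<open>0\<close> is the first
column, \<open>1\<close> the first row, \<open>2\<close> the second column, \<open>3\<close> the second row, and so on. Then \<open>x\<^sub>2\<^sub>i\<close> joins the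
vertices \<open>i + 1\<close> and \<open>i\<close>, and \<open>x\<^sub>2\<^sub>i\<^sub>+\<^sub>1\<close> joins \<open>i + 2\<close> to an older vertex \<open>q i < i\<close>, where
\<open>q 1 = 0\<close>, \<open>q 2 = 1\<close> and \<open>q i\<close> is \<open>i - 1\<close> or \<open>q (i - 2)\<close> according to the bit chosen
(\<open>ladder_iff\<close>). Put \<open>M = n + 2\<close>, and let \<open>X\<^sub>0 = x\<^sub>0\<close>, \<open>X\<^sub>i = x\<^sub>2\<^sub>i - x\<^sub>2\<^sub>i\<^sub>+\<^sub>1\<close> for \<open>0 < i < M\<close>,
\<open>X\<^sub>M = x\<^sub>2\<^sub>M\<close> be the sequence in question. The toric ring is identified with the subalgebra \<open>R\<close> of the
polynomial ring on the vertices that is generated by the edges.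

The reason for the theorem is that \<open>R\<close> is a free module over the polynomial ring \<open>k[X\<^sub>0, \<dots>, X\<^sub>M]\<close>: the
products of the \<open>x\<^sub>2\<^sub>i\<close> with \<open>i \<in> S\<close>, for \<open>S \<subseteq> {1, \<dots>, M - 1}\<close> without two consecutive elements, are a
module basis. Equivalently, the elements \<open>X\<^sup>a \<Prod>\<^sub>i\<^sub>\<in>\<^sub>S x\<^sub>2\<^sub>i\<close> form a basis over \<open>k\<close>. Multiplication by \<open>X\<^sub>i\<close> raises
the exponent \<open>a\<^sub>i\<close> by one, and the ideal generated by some of the \<open>X\<^sub>j\<close> is spanned by the basis elements in
which one of these \<open>X\<^sub>j\<close> has a positive exponent; regularity is then read off from coordinates
(\<open>param_regular\<close>, \<open>param_proper\<close>).

These elements span (\<open>lprod_in_span\<close>): modulo the sequence, both \<open>x\<^sub>2\<^sub>i\<close> and \<open>x\<^sub>2\<^sub>i\<^sub>+\<^sub>1\<close> become one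
element \<open>a\<^sub>i\<close>, with \<open>a\<^sub>0 = a\<^sub>M = 0\<close>, and cycles of length four give relations
\<open>a\<^sub>i\<^sup>2 = a\<^sub>i\<^sub>+\<^sub>1 a\<^sub>j\<close> with \<open>j < i\<close> and \<open>a\<^sub>i a\<^sub>i\<^sub>-\<^sub>1 = a\<^sub>i\<^sub>+\<^sub>1 a\<^sub>j\<close> with \<open>j < i - 1\<close>. Read from left to right, they
remove squares and consecutive factors and always raise the largest index involved, so that rewriting stops.

They are linearly independent by counting (\<open>basis_idx\<close>). For each pair \<open>(a, S)\<close> let the standard
monomial be the product of all \<open>x\<^sub>2\<^sub>i\<close> to the power \<open>a\<^sub>i\<close> for \<open>i \<notin> S\<close> and all \<open>x\<^sub>2\<^sub>i\<^sub>+\<^sub>1\<close> to the power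
\<open>a\<^sub>i + 1\<close> for \<open>i \<in> S\<close>; it has the degree of \<open>X\<^sup>a \<Prod>\<^sub>i\<^sub>\<in>\<^sub>S x\<^sub>2\<^sub>i\<close>. Different pairs have different standard
monomials in the vertices (\<open>vdeg_inj\<close>), so up to each degree the span has at least as large a dimension as
there are pairs, and a spanning family of that size is independent.\<close>

section \<open>Substitution as a ring homomorphism\<close>

definition monom_value :: "('e \<Rightarrow> 'a::comm_monoid_mult) \<Rightarrow> ('e \<Rightarrow>\<^sub>0 nat) \<Rightarrow> 'a" where
  "monom_value f m = (\<Prod>e\<in>Poly_Mapping.keys m. f e ^ Poly_Mapping.lookup m e)"

lemma monom_value_superset:
  assumes "finite A" "Poly_Mapping.keys m \<subseteq> A"
  shows "monom_value f m = (\<Prod>e\<in>A. f e ^ Poly_Mapping.lookup m e)"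
  unfolding monom_value_def
  by (rule prod.mono_neutral_left) (use assms in \<open>auto simp: in_keys_iff\<close>)

lemma monom_value_0 [simp]: "monom_value f 0 = 1"
  by (simp add: monom_value_def)

lemma monom_value_add: "monom_value f (m + m') = monom_value f m * monom_value f m'"
proof -
  let ?A = "Poly_Mapping.keys m \<union> Poly_Mapping.keys m'"
  have "monom_value f (m + m') = (\<Prod>e\<in>?A. f e ^ Poly_Mapping.lookup (m + m') e)"
    by (rule monom_value_superset) (use keys_add[of m m'] in auto)
  also have "\<dots> = monom_value f m * monom_value f m'"
    by (simp add: monom_value_superset[of ?A] lookup_add power_add prod.distrib)
  finally show ?thesis .
qed

lemma const_mult: "const a * const b = const (a * b)"
  by (simp add: const_def mult_single)

lemma const_add: "const a + const b = const (a + b)"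
  by (simp add: const_def single_add)

lemma const_0 [simp]: "const 0 = 0" and const_1 [simp]: "const 1 = 1"
  by (simp_all add: const_def)

interpretation mpol: vector_space "\<lambda>c p. const (c::'k::field) * (p :: ('v, 'k) mpol)"
  by unfold_locales (simp_all add: algebra_simps const_mult[symmetric] const_add[symmetric])

lemma mpol_eq_sum_single:
  "p = (\<Sum>m\<in>Poly_Mapping.keys p. Poly_Mapping.single m (Poly_Mapping.lookup p m))"
  by (rule poly_mapping_eqI)
    (simp add: lookup_sum lookup_single when_def in_keys_iff)

lemma subst_hom_alt:
  "subst_hom f p = (\<Sum>m\<in>Poly_Mapping.keys p. const (Poly_Mapping.lookup p m) * monom_value f m)"
  by (simp add: subst_hom_def monom_value_def)

lemma subst_hom_0 [simp]: "subst_hom f 0 = 0"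
  by (simp add: subst_hom_alt)

lemma subst_hom_add: "subst_hom f (p + q) = subst_hom f p + subst_hom f q"
  unfolding subst_hom_alt
  by (rule setsum_keys_plus_distrib) (simp_all add: algebra_simps flip: const_add)

lemma subst_hom_sum: "subst_hom f (sum g A) = (\<Sum>a\<in>A. subst_hom f (g a))"
  by (induction A rule: infinite_finite_induct) (simp_all add: subst_hom_add)

lemma subst_hom_single: "subst_hom f (Poly_Mapping.single m c) = const c * monom_value f m"
  by (cases "c = 0") (simp_all add: subst_hom_alt)

lemma subst_hom_mult: "subst_hom f (p * q) = subst_hom f p * subst_hom f q"
proof -
  let ?s = "\<lambda>p m. Poly_Mapping.single m (Poly_Mapping.lookup p m)"
  have "p * q = (\<Sum>m\<in>Poly_Mapping.keys p. ?s p m) * (\<Sum>m\<in>Poly_Mapping.keys q. ?s q m)"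
    using mpol_eq_sum_single[of p] mpol_eq_sum_single[of q] by simp
  also have "subst_hom f \<dots> = (\<Sum>m\<in>Poly_Mapping.keys p. \<Sum>m'\<in>Poly_Mapping.keys q.
      subst_hom f (?s p m) * subst_hom f (?s q m'))"
    by (simp add: sum_product subst_hom_sum mult_single subst_hom_single monom_value_add
        const_mult[symmetric] mult_ac)
  also have "\<dots> = subst_hom f p * subst_hom f q"
    by (simp add: subst_hom_single subst_hom_alt[of f p] subst_hom_alt[of f q] flip: sum_product)
  finally show ?thesis .
qed

lemma subst_hom_1 [simp]: "subst_hom f 1 = 1"
  using subst_hom_single[of f 0 1] by simp

lemma subst_hom_var: "subst_hom f (var v) = f v"
  by (simp add: var_def subst_hom_single monom_value_def)

lemma subst_hom_diff: "subst_hom f (p - q) = subst_hom f p - subst_hom f q"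
  using subst_hom_add[of f "p - q" q] by simp

lemma mpol_ring_sel [simp]:
  "monoid.mult (mpol_ring V) = (*)" "one (mpol_ring V) = 1" "zero (mpol_ring V) = 0" "add (mpol_ring V) = (+)"
  by (simp_all add: mpol_ring_def)

lemma in_carrier_mpol_ring:
  "p \<in> carrier (mpol_ring V) \<longleftrightarrow> (\<forall>m \<in> Poly_Mapping.keys p. Poly_Mapping.keys m \<subseteq> V)"
  by (simp add: mpol_ring_def)

lemma carrier_mpol_ring_single:
  "Poly_Mapping.keys m \<subseteq> V \<Longrightarrow> Poly_Mapping.single m c \<in> carrier (mpol_ring V)"
  by (auto simp: in_carrier_mpol_ring split: if_splits)

lemma carrier_mpol_ring_add:
  "p \<in> carrier (mpol_ring V) \<Longrightarrow> q \<in> carrier (mpol_ring V) \<Longrightarrow> p + q \<in> carrier (mpol_ring V)"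
  using keys_add[of p q] by (auto simp: in_carrier_mpol_ring)

lemma carrier_mpol_ring_uminus: "p \<in> carrier (mpol_ring V) \<Longrightarrow> - p \<in> carrier (mpol_ring V)"
  by (auto simp: in_carrier_mpol_ring in_keys_iff)

lemma carrier_mpol_ring_diff:
  "p \<in> carrier (mpol_ring V) \<Longrightarrow> q \<in> carrier (mpol_ring V) \<Longrightarrow> p - q \<in> carrier (mpol_ring V)"
  using carrier_mpol_ring_add[of p V "- q"] carrier_mpol_ring_uminus[of q V] by simp

lemma carrier_mpol_ring_mult:
  assumes "p \<in> carrier (mpol_ring V)" "q \<in> carrier (mpol_ring V)"
  shows "p * q \<in> carrier (mpol_ring V)"
  unfolding in_carrier_mpol_ring
proof
  fix m assume "m \<in> Poly_Mapping.keys (p * q)"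
  then obtain a b where "m = a + b" "a \<in> Poly_Mapping.keys p" "b \<in> Poly_Mapping.keys q"
    using keys_mult[of p q] by auto
  with assms show "Poly_Mapping.keys m \<subseteq> V"
    using keys_add[of a b] unfolding in_carrier_mpol_ring by blast
qed

lemma carrier_mpol_ring_1: "1 \<in> carrier (mpol_ring V)"
  by (simp add: in_carrier_mpol_ring)

lemma carrier_mpol_ring_const: "const c \<in> carrier (mpol_ring V)"
  by (simp add: const_def carrier_mpol_ring_single)

lemma carrier_mpol_ring_var: "v \<in> V \<Longrightarrow> var v \<in> carrier (mpol_ring V)"
  by (simp add: var_def carrier_mpol_ring_single)

lemma cring_mpol_ring: "cring (mpol_ring V)"
proof (rule cringI)
  show "abelian_group (mpol_ring V)"
  proof (rule abelian_groupI)
    fix p assume "p \<in> carrier (mpol_ring V)"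
    then show "\<exists>q\<in>carrier (mpol_ring V). q \<oplus>\<^bsub>mpol_ring V\<^esub> p = \<zero>\<^bsub>mpol_ring V\<^esub>"
      by (intro bexI[of _ "- p"]) (simp_all add: carrier_mpol_ring_uminus)
  qed (simp_all add: carrier_mpol_ring_add ac_simps, simp add: in_carrier_mpol_ring)
  show "comm_monoid (mpol_ring V)"
    by (rule comm_monoidI) (simp_all add: carrier_mpol_ring_mult carrier_mpol_ring_1 ac_simps)
qed (simp add: algebra_simps)

text \<open>The kernel depends on the target only through its zero, so the polynomial ring in all variables can serve
as the target for every vertex set.\<close>
lemma subst_hom_ring_hom: "ring_hom_ring (mpol_ring V) (mpol_ring UNIV) (subst_hom f)"
proof (rule ring_hom_ringI)
  show "ring (mpol_ring V)" "ring (mpol_ring UNIV)"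
    using cring_mpol_ring cring.axioms(1) by blast+
qed (simp_all add: in_carrier_mpol_ring subst_hom_add subst_hom_mult)

section \<open>Regular sequences in a quotient by a kernel\<close>

text \<open>The ideal that a list generates in the subring \<open>A\<close> of a ring. A subring is a set here, so that computations
with its elements are computations in the ambient type.\<close>
fun ideal_gen :: "'a::comm_ring_1 set \<Rightarrow> 'a list \<Rightarrow> 'a set" where
  "ideal_gen A [] = {0}"
| "ideal_gen A (y # ys) = {y * r + s | r s. r \<in> A \<and> s \<in> ideal_gen A ys}"

lemma ideal_gen_0: "0 \<in> A \<Longrightarrow> 0 \<in> ideal_gen A ys"
  by (induction ys) force+

lemma ideal_gen_add:
  assumes "\<And>a b. a \<in> A \<Longrightarrow> b \<in> A \<Longrightarrow> a + b \<in> A"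
  shows "u \<in> ideal_gen A ys \<Longrightarrow> v \<in> ideal_gen A ys \<Longrightarrow> u + v \<in> ideal_gen A ys"
proof (induction ys arbitrary: u v)
  case (Cons y ys)
  then obtain r s r' s' where *: "u = y * r + s" "v = y * r' + s'" "r \<in> A" "r' \<in> A"
    "s \<in> ideal_gen A ys" "s' \<in> ideal_gen A ys"
    by auto
  then have "u + v = y * (r + r') + (s + s')" by (simp add: algebra_simps)
  then show ?case
    using * Cons.IH assms unfolding ideal_gen.simps by blast
qed auto

lemma ideal_gen_mult:
  assumes "\<And>a b. a \<in> A \<Longrightarrow> b \<in> A \<Longrightarrow> a * b \<in> A"
  shows "a \<in> A \<Longrightarrow> u \<in> ideal_gen A ys \<Longrightarrow> a * u \<in> ideal_gen A ys"
proof (induction ys arbitrary: u)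
  case (Cons y ys)
  then obtain r s where *: "u = y * r + s" "r \<in> A" "s \<in> ideal_gen A ys"
    by auto
  then have "a * u = y * (a * r) + a * s" by (simp add: algebra_simps)
  then show ?case
    using * Cons assms unfolding ideal_gen.simps by blast
qed auto

lemma ideal_gen_base:
  assumes "0 \<in> A" shows "y \<in> set ys \<Longrightarrow> r \<in> A \<Longrightarrow> y * r \<in> ideal_gen A ys"
proof (induction ys)
  case (Cons z zs)
  show ?case
  proof (cases "y = z")
    case True
    then show ?thesis using Cons.prems ideal_gen_0[OF assms, of zs] by force
  next
    case False
    then have "y * r \<in> ideal_gen A zs" using Cons by auto
    then show ?thesis using assms by force
  qed
qed auto

text \<open>A homomorphism \<open>h\<close> between polynomial rings, the quotient \<open>Q\<close> of its source by its kernel, and its image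
\<open>A\<close>, which is isomorphic to \<open>Q\<close>.\<close>
locale toric_presentation =
  fixes V :: "'e set" and f :: "'e \<Rightarrow> ('v, 'k::field) mpol"
begin

abbreviation "S \<equiv> mpol_ring V :: ('e, 'k) mpol ring"
abbreviation "h \<equiv> subst_hom f"
abbreviation "I \<equiv> a_kernel S (mpol_ring UNIV) h"
abbreviation "A \<equiv> h ` carrier S"
abbreviation "Q \<equiv> S Quot I"
abbreviation "cl \<equiv> (+>\<^bsub>S\<^esub>) I"

sublocale S: cring S
  by (rule cring_mpol_ring)

sublocale h: ring_hom_ring S "mpol_ring UNIV" h
  by (rule subst_hom_ring_hom)

sublocale I: ideal I S
  by (rule h.kernel_is_ideal)

sublocale Q: cring Q
  by (rule I.quotient_is_cring[OF S.cring_axioms])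

sublocale cl: ring_hom_ring S Q cl
  by (rule I.rcos_ring_hom_ring)

lemma cl_surj: "carrier Q = cl ` carrier S"
  by (auto simp: FactRing_def A_RCOSETS_def')

lemma cl_eq_iff:
  assumes "a \<in> carrier S" "b \<in> carrier S"
  shows "cl a = cl b \<longleftrightarrow> h a = h b"
proof -
  have "cl x = {y \<in> carrier S. h y = h x}" if "x \<in> carrier S" for x
    by (rule h.rcos_eq_homeq[OF that])
  then show ?thesis using assms by auto
qed

lemma A_closed:
  "0 \<in> A" "1 \<in> A" "a \<in> A \<Longrightarrow> b \<in> A \<Longrightarrow> a + b \<in> A" "a \<in> A \<Longrightarrow> b \<in> A \<Longrightarrow> a * b \<in> A"
proof -
  show "0 \<in> A" using S.zero_closed h.hom_zero by force
  show "1 \<in> A" using S.one_closed h.hom_one by force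
  show "a + b \<in> A" if "a \<in> A" "b \<in> A"
  proof -
    from that obtain x y where "x \<in> carrier S" "y \<in> carrier S" "a = h x" "b = h y" by blast
    then show ?thesis by (intro image_eqI[of _ _ "x + y"]) (simp_all add: subst_hom_add carrier_mpol_ring_add)
  qed
  show "a * b \<in> A" if "a \<in> A" "b \<in> A"
  proof -
    from that obtain x y where "x \<in> carrier S" "y \<in> carrier S" "a = h x" "b = h y" by blast
    then show ?thesis by (intro image_eqI[of _ _ "x * y"]) (simp_all add: subst_hom_mult carrier_mpol_ring_mult)
  qed
qed

text \<open>The isomorphism between \<open>Q\<close> and \<open>A\<close> carries generated ideals to generated ideals. From left to right, the
classes of elements that \<open>h\<close> sends into the ideal of \<open>A\<close> form an ideal of \<open>Q\<close>; from right to left, an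
expression of \<open>h a\<close> by the generators lifts term by term, since a class is determined by its value under
\<open>h\<close>.\<close>
lemma cl_in_Idl_iff:
  assumes ys: "set ys \<subseteq> carrier S" and a: "a \<in> carrier S"
  shows "cl a \<in> Idl\<^bsub>Q\<^esub> (cl ` set ys) \<longleftrightarrow> h a \<in> ideal_gen A (map h ys)"
proof
  let ?K = "cl ` {b \<in> carrier S. h b \<in> ideal_gen A (map h ys)}"
  have gen_add: "u + v \<in> ideal_gen A zs" if "u \<in> ideal_gen A zs" "v \<in> ideal_gen A zs" for u v zs
    using ideal_gen_add[of A u zs v] A_closed(3) that by blast
  have gen_mult: "u * v \<in> ideal_gen A zs" if "u \<in> A" "v \<in> ideal_gen A zs" for u v zs
    using ideal_gen_mult[of A u v zs] A_closed(4) that by blast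
  have "ideal ?K Q"
  proof (rule idealI)
    show "ring Q" by (rule Q.ring_axioms)
    show "subgroup ?K (add_monoid Q)"
    proof (rule Q.add.subgroupI)
      show "?K \<subseteq> carrier Q" by (auto simp: cl_surj)
      have "cl 0 \<in> ?K"
        using ideal_gen_0[OF A_closed(1)] by (intro imageI) (simp add: in_carrier_mpol_ring)
      then show "?K \<noteq> {}" by blast
    next
      fix x assume "x \<in> ?K"
      then obtain b where b: "x = cl b" "b \<in> carrier S" "h b \<in> ideal_gen A (map h ys)" by auto
      have "h (- 1) \<in> A" by (rule imageI) (simp add: carrier_mpol_ring_uminus carrier_mpol_ring_1)
      from gen_mult[OF this b(3)] have "h (- 1 * b) \<in> ideal_gen A (map h ys)"
        by (simp only: subst_hom_mult)
      moreover have "\<ominus>\<^bsub>Q\<^esub> x = cl (- b)"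
      proof -
        have "cl (- b) \<oplus>\<^bsub>Q\<^esub> cl b = cl (- b + b)"
          using b(2) by (subst cl.hom_add[symmetric]) (simp_all add: carrier_mpol_ring_uminus)
        also have "\<dots> = \<zero>\<^bsub>Q\<^esub>" using cl.hom_zero by simp
        finally show ?thesis
          using b by (intro Q.minus_equality) (simp_all add: carrier_mpol_ring_uminus)
      qed
      ultimately show "\<ominus>\<^bsub>Q\<^esub> x \<in> ?K"
        using b(2) by (simp add: carrier_mpol_ring_uminus)
    next
      fix x y assume "x \<in> ?K" "y \<in> ?K"
      then obtain b c where b: "x = cl b" "b \<in> carrier S" "h b \<in> ideal_gen A (map h ys)"
        and c: "y = cl c" "c \<in> carrier S" "h c \<in> ideal_gen A (map h ys)" by auto
      have "x \<oplus>\<^bsub>Q\<^esub> y = cl (b + c)" using b c cl.hom_add[of b c] by simp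
      moreover have "h (b + c) \<in> ideal_gen A (map h ys)"
        using gen_add[OF b(3) c(3)] by (simp add: subst_hom_add)
      ultimately show "x \<oplus>\<^bsub>Q\<^esub> y \<in> ?K"
        using b c by (auto simp: carrier_mpol_ring_add)
    qed
    have mult_closed: "x \<otimes>\<^bsub>Q\<^esub> y \<in> ?K" if "y \<in> ?K" "x \<in> carrier Q" for x y
    proof -
      from that obtain b c where b: "y = cl b" "b \<in> carrier S" "h b \<in> ideal_gen A (map h ys)"
        and c: "x = cl c" "c \<in> carrier S" by (auto simp: cl_surj)
      have "x \<otimes>\<^bsub>Q\<^esub> y = cl (c * b)" using b c cl.hom_mult[of c b] by simp
      moreover have "h (c * b) \<in> ideal_gen A (map h ys)"
        using gen_mult[OF imageI[OF c(2)] b(3)] by (simp add: subst_hom_mult)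
      ultimately show ?thesis using b c by (auto simp: carrier_mpol_ring_mult)
    qed
    show "y \<otimes>\<^bsub>Q\<^esub> x \<in> ?K" if "y \<in> ?K" "x \<in> carrier Q" for x y
    proof -
      have "?K \<subseteq> carrier Q" by (auto simp: cl_surj)
      then have "y \<otimes>\<^bsub>Q\<^esub> x = x \<otimes>\<^bsub>Q\<^esub> y"
        using that by (intro Q.m_comm) auto
      then show ?thesis using mult_closed[OF that] by simp
    qed
    show "x \<otimes>\<^bsub>Q\<^esub> y \<in> ?K" if "y \<in> ?K" "x \<in> carrier Q" for x y
      by (rule mult_closed[OF that])
  qed
  moreover have "cl ` set ys \<subseteq> ?K"
  proof -
    have "h y \<in> ideal_gen A (map h ys)" if "y \<in> set ys" for y
      using ideal_gen_base[OF A_closed(1) _ A_closed(2), of "h y" "map h ys"] that by simp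
    then show ?thesis using ys by (intro image_mono) auto
  qed
  ultimately have "Idl\<^bsub>Q\<^esub> (cl ` set ys) \<subseteq> ?K"
    by (rule Q.genideal_minimal)
  moreover assume "cl a \<in> Idl\<^bsub>Q\<^esub> (cl ` set ys)"
  ultimately obtain b where "b \<in> carrier S" "cl a = cl b" "h b \<in> ideal_gen A (map h ys)"
    by auto
  then show "h a \<in> ideal_gen A (map h ys)"
    using a by (simp add: cl_eq_iff)
next
  assume "h a \<in> ideal_gen A (map h ys)"
  then show "cl a \<in> Idl\<^bsub>Q\<^esub> (cl ` set ys)"
    using ys a
  proof (induction ys arbitrary: a)
    case Nil
    then have "cl a = \<zero>\<^bsub>Q\<^esub>"
      using cl_eq_iff[of a 0] cl.hom_zero by (simp add: in_carrier_mpol_ring)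
    then show ?case
      using ideal.Icarr additive_subgroup.zero_closed[OF ideal.axioms(1)[OF Q.genideal_ideal]] by simp
  next
    case (Cons y ys)
    let ?J = "Idl\<^bsub>Q\<^esub> (cl ` set (y # ys))"
    have sub: "cl ` set (y # ys) \<subseteq> carrier Q"
      unfolding cl_surj using Cons.prems by (intro image_mono)
    interpret J: ideal ?J Q by (rule Q.genideal_ideal[OF sub])
    from Cons.prems obtain g s where g: "g \<in> carrier S" and s: "s \<in> ideal_gen A (map h ys)"
      and eq: "h a = h y * h g + s" by auto
    have y: "y \<in> carrier S" using Cons.prems by auto
    have rest: "a - y * g \<in> carrier S" "y * g \<in> carrier S"
      using Cons.prems y g by (auto intro: carrier_mpol_ring_diff carrier_mpol_ring_mult)
    have "h (a - y * g) \<in> ideal_gen A (map h ys)"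
      using s eq by (simp add: subst_hom_diff subst_hom_mult)
    then have "cl (a - y * g) \<in> Idl\<^bsub>Q\<^esub> (cl ` set ys)"
      using Cons rest by auto
    also have "\<dots> \<subseteq> ?J"
      using sub by (intro Q.genideal_minimal J.ideal_axioms subset_trans[OF _ Q.genideal_self[OF sub]]) auto
    finally have "cl (a - y * g) \<in> ?J" .
    moreover have "cl (y * g) \<in> ?J"
      using J.I_r_closed[of "cl y" "cl g"] Q.genideal_self[OF sub] y g cl.hom_mult[of y g] by simp
    ultimately have "cl (a - y * g) \<oplus>\<^bsub>Q\<^esub> cl (y * g) \<in> ?J"
      by (rule J.a_closed)
    then show ?case
      using rest cl.hom_add[of "a - y * g" "y * g"] by simp
  qed
qed

lemma regular_sequenceI:
  assumes xs: "set xs \<subseteq> carrier S"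
    and step: "\<And>i b. i < length xs \<Longrightarrow> b \<in> A \<Longrightarrow> h (xs ! i) * b \<in> ideal_gen A (map h (take i xs))
      \<Longrightarrow> b \<in> ideal_gen A (map h (take i xs))"
    and proper: "1 \<notin> ideal_gen A (map h xs)"
  shows "regular_sequence Q (map cl xs)"
  unfolding regular_sequence_def Let_def
proof (intro conjI allI impI)
  show "set (map cl xs) \<subseteq> carrier Q" using xs by (simp add: cl_surj image_mono)
  show "Idl\<^bsub>Q\<^esub> (set (map cl xs)) \<noteq> carrier Q"
  proof
    assume eq: "Idl\<^bsub>Q\<^esub> (set (map cl xs)) = carrier Q"
    have "cl 1 \<in> Idl\<^bsub>Q\<^esub> (cl ` set xs)"
      using cl.hom_closed[of 1] carrier_mpol_ring_1 eq by (metis list.set_map)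
    then have "h 1 \<in> ideal_gen A (map h xs)"
      using cl_in_Idl_iff[OF xs carrier_mpol_ring_1] by simp
    then show False using proper by simp
  qed
next
  fix i assume i: "i < length (map cl xs)"
  let ?ys = "take i xs"
  define J where "J = Idl\<^bsub>Q\<^esub> (set (take i (map cl xs)))"
  have ys: "set ?ys \<subseteq> carrier S" using xs by (auto dest: in_set_takeD)
  have J_eq: "J = Idl\<^bsub>Q\<^esub> (cl ` set ?ys)" by (simp add: J_def take_map)
  interpret J: ideal J Q
    unfolding J_eq by (rule Q.genideal_ideal) (use ys in \<open>simp add: cl_surj image_mono\<close>)
  interpret P: ring_hom_ring Q "Q Quot J" "(+>\<^bsub>Q\<^esub>) J" by (rule J.rcos_ring_hom_ring)
  have zero: "J +>\<^bsub>Q\<^esub> b = \<zero>\<^bsub>Q Quot J\<^esub> \<longleftrightarrow> b \<in> J" if "b \<in> carrier Q" for b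
  proof -
    have "\<zero>\<^bsub>Q Quot J\<^esub> = J" by (simp add: FactRing_def)
    then show ?thesis using J.a_rcos_self[OF that] J.a_rcos_const[of b] by metis
  qed
  have x: "xs ! i \<in> carrier S" using xs i by auto
  show "nonzerodivisor (Q Quot Idl\<^bsub>Q\<^esub> set (take i (map cl xs)))
     (Idl\<^bsub>Q\<^esub> set (take i (map cl xs)) +>\<^bsub>Q\<^esub> map cl xs ! i)"
    unfolding J_def[symmetric] nonzerodivisor_def
  proof (intro conjI ballI impI)
    show "J +>\<^bsub>Q\<^esub> map cl xs ! i \<in> carrier (Q Quot J)"
      using i x by (intro P.hom_closed) simp
    fix c assume "c \<in> carrier (Q Quot J)"
    then obtain y where "y \<in> carrier Q" "c = J +>\<^bsub>Q\<^esub> y"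
      unfolding FactRing_def[of Q J] A_RCOSETS_def' by auto
    then obtain b where b: "b \<in> carrier S" and c: "c = J +>\<^bsub>Q\<^esub> cl b"
      unfolding cl_surj by blast
    assume "(J +>\<^bsub>Q\<^esub> map cl xs ! i) \<otimes>\<^bsub>Q Quot J\<^esub> c = \<zero>\<^bsub>Q Quot J\<^esub>"
    then have "J +>\<^bsub>Q\<^esub> (cl (xs ! i) \<otimes>\<^bsub>Q\<^esub> cl b) = \<zero>\<^bsub>Q Quot J\<^esub>"
      using i x b c P.hom_mult[of "cl (xs ! i)" "cl b"] by simp
    then have "cl (xs ! i * b) \<in> J"
      using zero[of "cl (xs ! i) \<otimes>\<^bsub>Q\<^esub> cl b"] x b cl.hom_mult[of "xs ! i" b] by simp
    then have "h (xs ! i) * h b \<in> ideal_gen A (map h ?ys)"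
      using cl_in_Idl_iff[OF ys carrier_mpol_ring_mult[OF x b]] unfolding J_eq subst_hom_mult
      by (rule iffD1[rotated])
    then have "h b \<in> ideal_gen A (map h ?ys)"
      using step[OF _ imageI[OF b]] i by simp
    then have "cl b \<in> J" unfolding J_eq using cl_in_Idl_iff[OF ys b] by (rule iffD2[rotated])
    then show "c = \<zero>\<^bsub>Q Quot J\<^esub>" unfolding c using zero[OF cl.hom_closed[OF b]] by (rule iffD2[rotated])
  qed
qed

end

section \<open>Monomials as vectors\<close>
lemma single_power: "Poly_Mapping.single m (1::'k::field) ^ n = Poly_Mapping.single (\<Sum>j<n. m) 1"
  for m :: "'v \<Rightarrow>\<^sub>0 nat"
  by (induction n) (simp_all add: mult_single add.commute)

lemma single_prod: "(\<Prod>i\<in>I. Poly_Mapping.single (m i) (1::'k::field)) = Poly_Mapping.single (\<Sum>i\<in>I. m i) 1"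
  for m :: "'i \<Rightarrow> 'v \<Rightarrow>\<^sub>0 nat"
  by (induction I rule: infinite_finite_induct) (simp_all add: mult_single)

lemma lookup_const_mult: "Poly_Mapping.lookup (const c * p) m = c * Poly_Mapping.lookup p m"
  unfolding const_def mult_map_scale_conv_mult[symmetric] by (simp add: Poly_Mapping.map.rep_eq when_def)

lemma independent_monomials: "mpol.independent (range (\<lambda>m. Poly_Mapping.single m (1::'k::field)))"
  unfolding mpol.independent_explicit_finite_subsets
proof (intro allI impI ballI)
  fix S u v
  assume S: "S \<subseteq> range (\<lambda>m. Poly_Mapping.single m (1::'k))" "finite S"
    and eq: "(\<Sum>v\<in>S. const (u v) * v) = 0" and v: "v \<in> S"
  then obtain m where m: "v = Poly_Mapping.single m 1" by auto
  have "Poly_Mapping.lookup w m = (if w = v then 1 else 0)" if "w \<in> S" for w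
    using that S(1) m by (auto simp: lookup_single when_def)
  then have "(\<Sum>w\<in>S. u w * Poly_Mapping.lookup w m) = u v"
    using S(2) v by (simp add: if_distrib[of "(*) _"] sum.delta cong: if_cong)
  moreover have "(\<Sum>w\<in>S. u w * Poly_Mapping.lookup w m) = 0"
    using arg_cong[OF eq, of "\<lambda>p. Poly_Mapping.lookup p m"] by (simp add: lookup_sum lookup_const_mult)
  ultimately show "u v = 0" by simp
qed

lemma lookup_sum_const: "Poly_Mapping.lookup (\<Sum>j<n. m) v = n * Poly_Mapping.lookup m v"
  for m :: "'v \<Rightarrow>\<^sub>0 nat"
  by (simp add: lookup_sum)

section \<open>The edge monomials of a ladder\<close>

text \<open>All that matters about a ladder: each new vertex \<open>i + 2\<close> is joined to the vertex before it and to the end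
\<open>q i\<close> of a rung, which is an older neighbour of the vertex \<open>i\<close>.\<close>
locale ladder_monomials =
  fixes M :: nat and q :: "nat \<Rightarrow> nat" and \<sigma> :: "nat \<Rightarrow> 'v" and x :: "nat \<Rightarrow> ('v, 'k::field) mpol"
  assumes inj: "inj \<sigma>"
    and q_1: "q 1 = 0" and q_2: "q 2 = 1"
    and q_step: "\<And>i. 3 \<le> i \<Longrightarrow> q i = i - 1 \<or> q i = q (i - 2)"
    and x_even: "\<And>i. i \<le> M \<Longrightarrow> x (2 * i) = var (\<sigma> (i + 1)) * var (\<sigma> i)"
    and x_odd: "\<And>i. 1 \<le> i \<Longrightarrow> i < M \<Longrightarrow> x (2 * i + 1) = var (\<sigma> (i + 2)) * var (\<sigma> (q i))"
begin

abbreviation w :: "nat \<Rightarrow> ('v, 'k) mpol" where "w i \<equiv> var (\<sigma> i)"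

definition labels :: "nat set" where "labels = {..2 * M} - {1}"

text \<open>The proposed system of parameters \<open>X\<^sub>0, \<dots>, X\<^sub>M\<close>.\<close>
definition param :: "nat \<Rightarrow> ('v, 'k) mpol" where
  "param i = (if i = 0 \<or> i = M then x (2 * i) else x (2 * i) - x (2 * i + 1))"

definition sparse :: "nat set \<Rightarrow> bool" where
  "sparse S \<longleftrightarrow> S \<subseteq> {1..<M} \<and> (\<forall>i\<in>S. Suc i \<notin> S)"

definition idx :: "nat \<Rightarrow> ((nat \<Rightarrow> nat) \<times> nat set) set" where
  "idx D = {(a, S). (\<forall>i>M. a i = 0) \<and> sparse S \<and> (\<Sum>i\<le>M. a i) + card S \<le> D}"

definition basis :: "(nat \<Rightarrow> nat) \<times> nat set \<Rightarrow> ('v, 'k) mpol" where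
  "basis = (\<lambda>(a, S). (\<Prod>i\<le>M. param i ^ a i) * (\<Prod>i\<in>S. x (2 * i)))"

text \<open>The monomials outside the ideal generated by all \<open>x\<^sub>2\<^sub>i x\<^sub>2\<^sub>i\<^sub>+\<^sub>1\<close> and \<open>x\<^sub>2\<^sub>i\<^sub>+\<^sub>1 x\<^sub>2\<^sub>i\<^sub>-\<^sub>1\<close>, the left-hand sides of the
relations below. The exponent of an odd variable that occurs is positive, whence the shift by one.\<close>
definition standard :: "(nat \<Rightarrow> nat) \<times> nat set \<Rightarrow> ('v, 'k) mpol" where
  "standard = (\<lambda>(a, S). \<Prod>i\<le>M. if i \<in> S then x (2 * i + 1) ^ (a i + 1) else x (2 * i) ^ a i)"

lemma q_less: "1 \<le> i \<Longrightarrow> q i < i"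
proof (induction i rule: less_induct)
  case (less i)
  consider "i = 1" | "i = 2" | "3 \<le> i" using less.prems by linarith
  then show ?case
  proof cases
    case 3
    then show ?thesis using q_step[OF 3] less.IH[of "i - 2"] by force
  qed (use q_1 q_2 in auto)
qed

text \<open>The vertex \<open>i\<close> is adjacent to \<open>q i\<close>: both alternatives for \<open>q i\<close> name an older neighbour of \<open>i\<close>. The bound
on the label \<open>c\<close> makes the rewriting of products terminate.\<close>
lemma rung_product:
  assumes "1 \<le> i" "i < M"
  shows "\<exists>c<2 * i. c \<noteq> 1 \<and> w i * w (q i) = x c"
proof -
  consider "i = 1" | "i = 2" | "3 \<le> i" using assms by linarith
  then show ?thesis
  proof cases
    case 1
    then show ?thesis using x_even[of 0] q_1 by (intro exI[of _ 0]) simp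
  next
    case 2
    then show ?thesis using x_even[of 1] q_2 assms by (intro exI[of _ 2]) (simp add: numeral_2_eq_2)
  next
    case 3
    from q_step[OF 3] show ?thesis
    proof
      assume "q i = i - 1"
      then show ?thesis using 3 assms x_even[of "i - 1"] by (intro exI[of _ "2 * (i - 1)"]) auto
    next
      assume "q i = q (i - 2)"
      then show ?thesis using 3 assms x_odd[of "i - 2"]
        by (intro exI[of _ "2 * (i - 2) + 1"]) (auto simp: Suc_diff_Suc numeral_2_eq_2)
    qed
  qed
qed

text \<open>Consecutive rung ends are adjacent. If \<open>q i = i - 1\<close>, this is the previous lemma for \<open>i - 1\<close>; if
\<open>q i = q (i - 2)\<close>, the pair of rung ends is the one found for \<open>i - 1\<close>.\<close>
lemma rung_end_product:
  assumes "2 \<le> i" "i < M"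
  shows "\<exists>c<2 * i - 2. c \<noteq> 1 \<and> w (q i) * w (q (i - 1)) = x c"
  using assms
proof (induction i rule: less_induct)
  case (less i)
  show ?case
  proof (cases "i = 2")
    case True
    then show ?thesis using x_even[of 0] q_1 q_2 by (intro exI[of _ 0]) simp
  next
    case False
    then have i: "3 \<le> i" using less.prems by simp
    from q_step[OF i] show ?thesis
    proof
      assume "q i = i - 1"
      then show ?thesis using rung_product[of "i - 1"] less.prems by (auto simp: right_diff_distrib')
    next
      assume q: "q i = q (i - 2)"
      obtain c where "c < 2 * (i - 1) - 2" "c \<noteq> 1" "w (q (i - 1)) * w (q (i - 1 - 1)) = x c"
        using less.IH[of "i - 1"] i less.prems by force
      moreover have "i - 1 - 1 = i - 2" by simp
      ultimately show ?thesis using q by (intro exI[of _ c]) (auto simp: mult.commute)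
    qed
  qed
qed

text \<open>The relation of the four-cycle through \<open>i + 2\<close>, \<open>i + 1\<close>, \<open>i\<close> and \<open>q i\<close>. Modulo the parameters its left-hand
side is a square.\<close>
lemma relation_square:
  assumes "1 \<le> i" "i < M"
  shows "\<exists>c<2 * i. c \<noteq> 1 \<and> x (2 * i) * x (2 * i + 1) = x (2 * i + 2) * x c"
proof -
  obtain c where c: "c < 2 * i" "c \<noteq> 1" "w i * w (q i) = x c" using rung_product[OF assms] by blast
  have "x (2 * i + 2) = w (i + 2) * w (i + 1)" using x_even[of "i + 1"] assms by simp
  moreover have "x (2 * i) * x (2 * i + 1) = w (i + 2) * w (i + 1) * (w i * w (q i))"
    using x_even[of i] x_odd[OF assms] assms by (simp add: mult_ac)
  ultimately show ?thesis using c by auto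
qed

text \<open>The relation of the four-cycle through \<open>i + 2\<close>, \<open>i + 1\<close> and the rung ends of both. Modulo the parameters its
left-hand side is a product of neighbouring factors.\<close>
lemma relation_consecutive:
  assumes "2 \<le> i" "i < M"
  shows "\<exists>c<2 * i - 2. c \<noteq> 1 \<and> x (2 * i + 1) * x (2 * i - 1) = x (2 * i + 2) * x c"
proof -
  obtain c where c: "c < 2 * i - 2" "c \<noteq> 1" "w (q i) * w (q (i - 1)) = x c"
    using rung_end_product[OF assms] by blast
  have "x (2 * i + 2) = w (i + 2) * w (i + 1)" using x_even[of "i + 1"] assms by simp
  moreover have "x (2 * i - 1) = w (i + 1) * w (q (i - 1))"
    using x_odd[of "i - 1"] assms by (simp add: right_diff_distrib' Suc_diff_Suc numeral_2_eq_2)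
  then have "x (2 * i + 1) * x (2 * i - 1) = w (i + 2) * w (i + 1) * (w (q i) * w (q (i - 1)))"
    using x_odd[of i] assms by (simp add: mult_ac)
  ultimately show ?thesis using c by auto
qed

lemma idx_mono: "D \<le> E \<Longrightarrow> idx D \<subseteq> idx E"
  by (auto simp: idx_def)

lemma idx_shift: "(a, S) \<in> idx D \<Longrightarrow> i \<le> M \<Longrightarrow> (a(i := Suc (a i)), S) \<in> idx (Suc D)"
proof -
  assume "(a, S) \<in> idx D" "i \<le> M"
  moreover from \<open>i \<le> M\<close> have "(\<Sum>j\<le>M. (a(i := Suc (a i))) j) = Suc (\<Sum>j\<le>M. a j)"
    by (simp add: sum.remove[of "{..M}" i])
  ultimately show ?thesis by (auto simp: idx_def)
qed

lemma basis_shift: "i \<le> M \<Longrightarrow> basis (a(i := Suc (a i)), S) = param i * basis (a, S)"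
  by (simp add: basis_def prod.remove[of "{..M}" i] mult_ac)

lemma param_mult_span:
  assumes "i \<le> M" "v \<in> mpol.span (basis ` idx D)"
  shows "param i * v \<in> mpol.span (basis ` idx (Suc D))"
  using assms(2)
proof (induction rule: mpol.span_induct_alt)
  case base
  then show ?case by (simp add: mpol.span_zero)
next
  case (step c z y)
  then obtain a S where "z = basis (a, S)" "(a, S) \<in> idx D" by auto
  then have "param i * z \<in> basis ` idx (Suc D)"
    using basis_shift[of i a S] idx_shift[of a S D i] assms(1) by (metis image_eqI)
  then have "const c * (param i * z) + param i * y \<in> mpol.span (basis ` idx (Suc D))"
    by (intro mpol.span_add mpol.span_scale mpol.span_base step)
  then show ?case by (simp add: algebra_simps)
qed

subsection \<open>Spanning\<close>
abbreviation lprod :: "nat multiset \<Rightarrow> ('v, 'k) mpol" where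
  "lprod A \<equiv> \<Prod>l\<in>#A. x l"

text \<open>Doubling the contribution with each step of \<open>l div 2\<close> makes both relations increase the weight, because
\<open>2\<^sup>i + 2\<^sup>i\<close> and \<open>2\<^sup>i + 2\<^sup>i\<^sup>-\<^sup>1\<close> do not exceed \<open>2\<^sup>i\<^sup>+\<^sup>1\<close> and the second new factor adds a positive amount. The
subtracted parity makes replacing \<open>x\<^sub>2\<^sub>i\<^sub>+\<^sub>1\<close> by \<open>x\<^sub>2\<^sub>i\<close> an increase as well, and the factor \<open>4\<close> keeps every
contribution positive in spite of it.\<close>
definition weight :: "nat multiset \<Rightarrow> nat" where
  "weight A = (\<Sum>l\<in>#A. 4 * 2 ^ (l div 2) - l mod 2)"

lemma weight_simps [simp]:
  "weight {#} = 0" "weight (add_mset l A) = (4 * 2 ^ (l div 2) - l mod 2) + weight A"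
  by (simp_all add: weight_def)

lemma weight_bound: "set_mset A \<subseteq> labels \<Longrightarrow> weight A \<le> size A * (4 * 2 ^ M)"
proof (induction A)
  case (add l A)
  then have "l div 2 \<le> M" by (auto simp: labels_def)
  then have "(2::nat) ^ (l div 2) \<le> 2 ^ M" by simp
  then have "4 * 2 ^ (l div 2) - l mod 2 \<le> 4 * 2 ^ M" by linarith
  then show ?case using add by auto
qed simp

text \<open>Induction on the number of factors, and for a fixed number on the distance of the weight from its maximum.
A product that contains \<open>x\<^sub>0\<close> or \<open>x\<^sub>2\<^sub>M\<close> is a multiple of a parameter. Otherwise, up to multiples of
parameters, an odd variable is replaced by the even one, and a square or a pair of neighbouring even
variables is rewritten by the corresponding relation. What is left is the product over a sparse set.\<close>
lemma lprod_in_span: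
  "set_mset A \<subseteq> labels \<Longrightarrow> lprod A \<in> mpol.span (basis ` idx (size A))"
proof (induction "size A" arbitrary: A)
  case 0
  have "(\<lambda>_. 0, {}) \<in> idx 0" by (simp add: idx_def sparse_def)
  then have "basis (\<lambda>_. 0, {}) \<in> basis ` idx 0" by (rule imageI)
  moreover have "basis (\<lambda>_. 0, {}) = 1" by (simp add: basis_def)
  ultimately show ?case using 0 by (auto intro: mpol.span_base)
next
  case (Suc D)
  let ?W = "mpol.span (basis ` idx (Suc D))"
  have P: "param i * lprod A' \<in> ?W" if "i \<le> M" "size A' = D" "set_mset A' \<subseteq> labels" for i A'
    using Suc.hyps(1)[of A'] param_mult_span[of i "lprod A'" D] that by auto
  have "lprod A \<in> ?W" if "size A = Suc D" "set_mset A \<subseteq> labels" for A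
    using that
  proof (induction "Suc D * (4 * 2 ^ M) - weight A" arbitrary: A rule: less_induct)
    case less
    have IH: "lprod B \<in> ?W" if "size B = Suc D" "set_mset B \<subseteq> labels" "weight A < weight B" for B
    proof -
      have "weight B \<le> Suc D * (4 * 2 ^ M)" using weight_bound[of B] that by simp
      then show ?thesis using less.hyps[of B] that by simp
    qed
    \<comment> \<open>splits off one factor, leaving a product to which the outer induction applies\<close>
    have split1: "\<exists>A'. A = add_mset l A' \<and> size A' = D \<and> set_mset A' \<subseteq> labels" if l: "l \<in># A" for l
    proof -
      obtain A' where "A = add_mset l A'" using mset_add[OF l] .
      then show ?thesis using less.prems by auto
    qed
    consider (ends) "0 \<in># A \<or> 2 * M \<in># A"
      | (odd) i where "1 \<le> i" "i < M" "2 * i + 1 \<in># A"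
      | (square) i A' where "1 \<le> i" "i < M" "A = add_mset (2 * i) (add_mset (2 * i) A')"
      | (consecutive) i where "2 \<le> i" "i < M" "2 * i \<in># A" "2 * i - 2 \<in># A"
      | (sparse) "\<And>l. l \<in># A \<Longrightarrow> \<exists>i. 1 \<le> i \<and> i < M \<and> l = 2 * i" "\<And>l. count A l \<le> 1"
          "\<And>i. 2 \<le> i \<Longrightarrow> i < M \<Longrightarrow> 2 * i \<in># A \<Longrightarrow> 2 * i - 2 \<notin># A"
    proof -
      have pos: "\<exists>i. 1 \<le> i \<and> i < M \<and> l = 2 * i" if "l \<in># A"
        and no_odd: "\<And>i. 1 \<le> i \<Longrightarrow> i < M \<Longrightarrow> 2 * i + 1 \<notin># A" and no_end: "\<not> (0 \<in># A \<or> 2 * M \<in># A)" for l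
      proof (cases "even l")
        case True
        then obtain i where "l = 2 * i" by auto
        moreover have "l \<noteq> 0" "l \<noteq> 2 * M" "l \<le> 2 * M" using that less.prems by (auto simp: labels_def)
        ultimately show ?thesis by (intro exI[of _ i]) auto
      next
        case False
        then obtain i where i: "l = 2 * i + 1" using oddE by blast
        moreover have "l \<noteq> 1" "l \<le> 2 * M" using that less.prems by (auto simp: labels_def)
        ultimately have "1 \<le> i" "i < M" by auto
        then show ?thesis using no_odd[of i] i that by auto
      qed
      have dup: "\<exists>A'. A = add_mset l (add_mset l A')" if "\<not> count A l \<le> 1" for l
      proof -
        have "{#l, l#} \<subseteq># A" using that by (auto simp: subseteq_mset_def)
        then show ?thesis by (metis add_mset_add_single mset_subset_eq_exists_conv union_mset_add_mset_left add.left_neutral)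
      qed
      have "l \<in># A" if "\<not> count A l \<le> 1" for l using that by (auto simp: count_inI)
      with pos dup that show thesis by metis
    qed
    then show ?case
    proof cases
      case ends
      then obtain i where i: "i = 0 \<or> i = M" "2 * i \<in># A" by (metis mult_0_right)
      then obtain A' where A': "A = add_mset (2 * i) A'" "size A' = D" "set_mset A' \<subseteq> labels"
        using split1 by blast
      have "lprod A = param i * lprod A'" using A' i by (auto simp: param_def)
      then show ?thesis using P[of i A'] A' i by auto
    next
      case odd
      then obtain A' where A': "A = add_mset (2 * i + 1) A'" "size A' = D" "set_mset A' \<subseteq> labels"
        using split1 by blast
      have "lprod (add_mset (2 * i) A') \<in> ?W"
        using A' odd by (intro IH) (auto simp: labels_def)
      moreover have "lprod A = lprod (add_mset (2 * i) A') - param i * lprod A'"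
        using A' odd by (simp add: param_def algebra_simps)
      ultimately show ?thesis using P[of i A'] A' odd by (simp add: mpol.span_diff)
    next
      case square
      obtain c where c: "c < 2 * i" "c \<noteq> 1" "x (2 * i) * x (2 * i + 1) = x (2 * i + 2) * x c"
        using relation_square square by blast
      have A': "size A' + 1 = D" "set_mset (add_mset (2 * i) A') \<subseteq> labels"
        using square less.prems by auto
      have w: "4 * 2 ^ i * 2 = (4 * 2 ^ Suc i :: nat)" "1 < 4 * 2 ^ (c div 2) - c mod 2"
        using one_le_power[of "2::nat" "c div 2"] by (simp, linarith)
      have "lprod (add_mset (2 * i + 2) (add_mset c A')) \<in> ?W"
      proof (intro IH)
        show "weight A < weight (add_mset (2 * i + 2) (add_mset c A'))" using w square by simp
      qed (use A' c square in \<open>auto simp: labels_def\<close>)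
      moreover have "lprod A = lprod (add_mset (2 * i + 2) (add_mset c A')) + param i * lprod (add_mset (2 * i) A')"
      proof -
        have "lprod A = x (2 * i) * (x (2 * i + 1) + param i) * lprod A'"
          using square by (simp add: param_def mult_ac)
        also have "\<dots> = x (2 * i) * x (2 * i + 1) * lprod A' + param i * (x (2 * i) * lprod A')"
          by (simp add: algebra_simps)
        finally show ?thesis unfolding c(3) by (simp add: mult_ac)
      qed
      ultimately show ?thesis using P[of i "add_mset (2 * i) A'"] A' square by (simp add: mpol.span_add)
    next
      case consecutive
      obtain c where c: "c < 2 * i - 2" "c \<noteq> 1" "x (2 * i + 1) * x (2 * i - 1) = x (2 * i + 2) * x c"
        using relation_consecutive consecutive by blast
      obtain B where B: "A = add_mset (2 * i) B" "size B = D" "set_mset B \<subseteq> labels"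
        using split1 consecutive by blast
      have "2 * i - 2 \<in># B" using B consecutive by auto
      then obtain A' where A': "B = add_mset (2 * i - 2) A'" by (meson mset_add)
      obtain j where j: "i = Suc j" "1 \<le> j" using consecutive by (cases i) auto
      have w: "4 * 2 ^ j * 2 + 4 * 2 ^ j \<le> (4 * 2 ^ Suc i :: nat)" "1 < 4 * 2 ^ (c div 2) - c mod 2"
        using one_le_power[of "2::nat" "c div 2"] j by (simp, linarith)
      have "lprod (add_mset (2 * i + 2) (add_mset c A')) \<in> ?W"
      proof (intro IH)
        show "weight A < weight (add_mset (2 * i + 2) (add_mset c A'))" using w j B A' by simp
      qed (use B A' c consecutive in \<open>auto simp: labels_def\<close>)
      moreover have "param i * lprod (add_mset (2 * i - 1) A') \<in> ?W"
        using B A' consecutive by (intro P) (auto simp: labels_def)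
      moreover have "param j * lprod (add_mset (2 * i) A') \<in> ?W"
        using B A' consecutive j by (intro P) (auto simp: labels_def)
      moreover have "lprod A = lprod (add_mset (2 * i + 2) (add_mset c A'))
        + param i * lprod (add_mset (2 * i - 1) A') + param j * lprod (add_mset (2 * i) A')"
      proof -
        have pi: "x (2 * i) = x (2 * i + 1) + param i" and pj: "x (2 * i - 2) = x (2 * i - 1) + param j"
          using consecutive j by (auto simp: param_def)
        have "x (2 * i) * x (2 * i - 1) = x (2 * i + 1) * x (2 * i - 1) + param i * x (2 * i - 1)"
          by (subst pi) (rule distrib_right)
        note pi = this
        have "lprod A = x (2 * i) * x (2 * i - 2) * lprod A'"
          using A' B by (simp add: mult_ac)
        also have "\<dots> = (x (2 * i) * x (2 * i - 1)) * lprod A' + param j * (x (2 * i) * lprod A')"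
          unfolding pj by (simp add: algebra_simps)
        also have "\<dots> = (x (2 * i + 1) * x (2 * i - 1)) * lprod A' + param i * (x (2 * i - 1) * lprod A')
          + param j * (x (2 * i) * lprod A')"
          unfolding pi by (simp add: algebra_simps)
        finally show ?thesis unfolding c(3) by (simp add: mult_ac)
      qed
      ultimately show ?thesis by (simp add: mpol.span_add)
    next
      case sparse
      define S where "S = {i. 2 * i \<in># A}"
      have "A = mset_set (set_mset A)"
        by (rule multiset_eqI) (use sparse(2) in \<open>auto simp: count_mset_set' not_in_iff intro: le_antisym\<close>)
      also have "set_mset A = (\<lambda>i. 2 * i) ` S" using sparse(1) by (fastforce simp: S_def)
      finally have A: "A = mset_set ((\<lambda>i. 2 * i) ` S)" .
      have S: "S \<subseteq> {1..<M}" using sparse(1) by (fastforce simp: S_def)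
      then have fin: "finite S" using finite_subset by blast
      have inj2: "inj_on (\<lambda>i. 2 * i) S" for S :: "nat set" by (auto simp: inj_on_def)
      have "sparse S" unfolding sparse_def
        using S sparse(3)[of "Suc _"] by (fastforce simp: S_def)
      moreover have "card S = Suc D" using less.prems A fin by (metis card_image inj2 size_mset_set)
      ultimately have "(\<lambda>_. 0, S) \<in> idx (Suc D)" by (simp add: idx_def)
      then have "basis (\<lambda>_. 0, S) \<in> ?W" by (intro mpol.span_base imageI)
      moreover have "basis (\<lambda>_. 0, S) = lprod A"
      proof -
        have "lprod A = prod x ((\<lambda>i. 2 * i) ` S)" unfolding A by (simp add: prod_unfold_prod_mset)
        then show ?thesis using inj2 by (simp add: basis_def prod.reindex)
      qed
      ultimately show ?thesis by simp
    qed
  qed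
  then show ?case using Suc by metis
qed


subsection \<open>Standard monomials are distinct\<close>

text \<open>The degree at the vertex \<open>v\<close> of the factor with index \<open>i\<close> of the standard monomial of \<open>(a, S)\<close>.\<close>
definition term_deg :: "(nat \<Rightarrow> nat) \<Rightarrow> nat set \<Rightarrow> nat \<Rightarrow> nat \<Rightarrow> nat" where
  "term_deg a S i v = (if i \<in> S then (a i + 1) * (of_bool (v = i + 2) + of_bool (v = q i))
     else a i * (of_bool (v = i + 1) + of_bool (v = i)))"

definition vdeg :: "nat \<Rightarrow> (nat \<Rightarrow> nat) \<Rightarrow> nat set \<Rightarrow> nat \<Rightarrow> nat" where
  "vdeg m a S v = (\<Sum>i\<le>m. term_deg a S i v)"

lemma term_deg_above: "0 \<notin> S \<Longrightarrow> i + 2 < v \<Longrightarrow> term_deg a S i v = 0"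
  using q_less[of i] by (cases "i = 0") (auto simp: term_deg_def)

lemma vdeg_above: "0 \<notin> S \<Longrightarrow> m + 2 < v \<Longrightarrow> vdeg m a S v = 0"
  by (auto simp: vdeg_def term_deg_above)

lemma vdeg_Suc: "vdeg (Suc m) a S v = vdeg m a S v + term_deg a S (Suc m) v"
  by (simp add: vdeg_def)

text \<open>Among \<open>x\<^sub>0, \<dots>, x\<^sub>2\<^sub>m\<^sub>+\<^sub>1\<close>, only the last variable has the vertex \<open>m + 2\<close> as an end.\<close>
lemma vdeg_top:
  assumes "0 \<notin> S"
  shows "vdeg m a S (m + 2) = (if m \<in> S then a m + 1 else 0)"
proof (cases m)
  case 0
  then show ?thesis using assms by (simp add: vdeg_def term_deg_def)
next
  case (Suc k)
  then show ?thesis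
    using vdeg_above[OF assms, of k "m + 2" a] q_less[of m] by (simp add: vdeg_Suc term_deg_def)
qed

text \<open>The variable \<open>x\<^sub>2\<^sub>m\<close> contributes \<open>a m\<close> to both of its ends \<open>m\<close> and \<open>m + 1\<close>. If \<open>x\<^sub>2\<^sub>m\<^sub>-\<^sub>1\<close> is absent, nothing else
contributes to \<open>m + 1\<close>. If it is present, then \<open>x\<^sub>2\<^sub>m\<^sub>-\<^sub>2\<close> is absent by the shape of a standard monomial and
\<open>x\<^sub>2\<^sub>m\<^sub>-\<^sub>3\<close> by sparseness, so that nothing else contributes to \<open>m\<close>.\<close>
lemma vdeg_min:
  assumes S: "0 \<notin> S" "\<forall>i\<in>S. Suc i \<notin> S" and m: "m \<notin> S"
  shows "a m = min (vdeg m a S (m + 1)) (vdeg m a S m)"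
proof -
  have ge: "a m \<le> vdeg m a S v" if "v = m \<or> v = m + 1" for v
    using member_le_sum[of m "{..m}" "\<lambda>i. term_deg a S i v"] m that
    by (auto simp: vdeg_def term_deg_def)
  have "vdeg m a S (m + 1) = a m \<or> vdeg m a S m = a m"
  proof (cases m)
    case 0
    then show ?thesis using m by (simp add: vdeg_def term_deg_def)
  next
    case (Suc k)
    show ?thesis
    proof (cases "k \<in> S")
      case False
      then have "vdeg k a S (m + 1) = 0" using vdeg_top[OF S(1), of k a] Suc by simp
      then show ?thesis using Suc m by (simp add: vdeg_Suc term_deg_def)
    next
      case True
      then obtain l where l: "k = Suc l" using S(1) by (cases k) auto
      have "l \<notin> S" using S(2) True l by auto
      then have "vdeg l a S m = 0" using vdeg_top[OF S(1), of l a] l Suc by simp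
      then have "vdeg m a S m = a m"
        using True m l Suc q_less[of k] by (simp add: vdeg_Suc term_deg_def)
      then show ?thesis by simp
    qed
  qed
  then show ?thesis using ge[of m] ge[of "m + 1"] by auto
qed

text \<open>The last factor can be recovered from the degrees and divided out: the vertex \<open>m + 2\<close> tells whether it is
odd and gives its exponent in that case, and otherwise the exponent is the minimum above.\<close>
lemma vdeg_inj:
  assumes "0 \<notin> S" "\<forall>i\<in>S. Suc i \<notin> S" "0 \<notin> S'" "\<forall>i\<in>S'. Suc i \<notin> S'"
    and "\<And>v. vdeg m a S v = vdeg m a' S' v" "i \<le> m"
  shows "a i = a' i \<and> (i \<in> S \<longleftrightarrow> i \<in> S')"
  using assms(5,6)
proof (induction m arbitrary: i)
  case 0
  then show ?case using vdeg_min[of S 0 a] vdeg_min[of S' 0 a'] assms(1-4) by simp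
next
  case (Suc m)
  note top = vdeg_top[OF assms(1), of "Suc m" a] vdeg_top[OF assms(3), of "Suc m" a']
    Suc.prems(1)[of "Suc m + 2"]
  have mem: "Suc m \<in> S \<longleftrightarrow> Suc m \<in> S'"
    using top by (auto split: if_splits)
  have val: "a (Suc m) = a' (Suc m)"
  proof (cases "Suc m \<in> S")
    case True
    then show ?thesis using top mem by simp
  next
    case False
    then show ?thesis
      using vdeg_min[OF assms(1,2) False, of a] vdeg_min[OF assms(3,4), of "Suc m" a'] mem Suc.prems(1)
      by simp
  qed
  have "vdeg m a S v = vdeg m a' S' v" for v
    using Suc.prems(1)[of v] mem val by (simp add: vdeg_Suc term_deg_def split: if_splits)
  then show ?case using Suc.IH[of i] Suc.prems(2) mem val by (cases "i = Suc m") auto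
qed

lemma sparseD: "sparse S \<Longrightarrow> 0 \<notin> S" "sparse S \<Longrightarrow> \<forall>i\<in>S. Suc i \<notin> S"
  by (auto simp: sparse_def)

definition label_exp :: "nat \<Rightarrow> ('v \<Rightarrow>\<^sub>0 nat)" where
  "label_exp l = (if even l then Poly_Mapping.single (\<sigma> (l div 2 + 1)) 1 + Poly_Mapping.single (\<sigma> (l div 2)) 1
     else Poly_Mapping.single (\<sigma> (l div 2 + 2)) 1 + Poly_Mapping.single (\<sigma> (q (l div 2))) 1)"

lemma x_eq_single: "l \<in> labels \<Longrightarrow> x l = Poly_Mapping.single (label_exp l) 1"
proof (cases "even l")
  case True
  assume "l \<in> labels"
  with True obtain i where "l = 2 * i" "i \<le> M" by (auto simp: labels_def)
  then show ?thesis using x_even[of i] by (simp add: label_exp_def var_def mult_single)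
next
  case False
  assume "l \<in> labels"
  with False obtain i where "l = 2 * i + 1" "1 \<le> i" "i < M" by (auto simp: labels_def elim!: oddE)
  then show ?thesis using x_odd[of i] by (simp add: label_exp_def var_def mult_single)
qed

lemma lookup_label_exp:
  "Poly_Mapping.lookup (label_exp (2 * i)) (\<sigma> v) = of_bool (v = i + 1) + of_bool (v = i)"
  "Poly_Mapping.lookup (label_exp (2 * i + 1)) (\<sigma> v) = of_bool (v = i + 2) + of_bool (v = q i)"
  using inj by (auto simp: label_exp_def lookup_add lookup_single when_def inj_eq)

lemma standard_eq_single:
  assumes "sparse S"
  obtains m where "standard (a, S) = Poly_Mapping.single m 1" "\<And>v. Poly_Mapping.lookup m (\<sigma> v) = vdeg M a S v"
proof
  let ?m = "\<lambda>i. if i \<in> S then \<Sum>j<a i + 1. label_exp (2 * i + 1) else \<Sum>j<a i. label_exp (2 * i)"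
  have "standard (a, S) = (\<Prod>i\<le>M. Poly_Mapping.single (?m i) 1)"
    unfolding standard_def prod.case
  proof (rule prod.cong)
    fix i assume i: "i \<in> {..M}"
    then have "2 * i \<in> labels" by (auto simp: labels_def)
    moreover have "2 * i + 1 \<in> labels" if "i \<in> S" using assms that by (auto simp: labels_def sparse_def)
    ultimately show "(if i \<in> S then x (2 * i + 1) ^ (a i + 1) else x (2 * i) ^ a i) = Poly_Mapping.single (?m i) 1"
      by (cases "i \<in> S") (simp_all only: x_eq_single single_power if_True if_False)
  qed simp
  then show "standard (a, S) = Poly_Mapping.single (\<Sum>i\<le>M. ?m i) 1" by (simp only: single_prod)
  show "Poly_Mapping.lookup (\<Sum>i\<le>M. ?m i) (\<sigma> v) = vdeg M a S v" for v
    unfolding vdeg_def lookup_sum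
    by (rule sum.cong) (simp_all only: if_distrib[of "\<lambda>p. Poly_Mapping.lookup p _"]
      lookup_sum_const lookup_label_exp term_deg_def)
qed

lemma inj_on_standard: "inj_on standard (idx D)"
proof (rule inj_onI, clarify)
  fix a S a' S' assume idx: "(a, S) \<in> idx D" "(a', S') \<in> idx D" and eq: "standard (a, S) = standard (a', S')"
  then have S: "sparse S" "sparse S'" by (auto simp: idx_def)
  obtain m where m: "standard (a, S) = Poly_Mapping.single m 1" "\<And>v. Poly_Mapping.lookup m (\<sigma> v) = vdeg M a S v"
    using standard_eq_single[OF S(1)] by blast
  obtain m' where m': "standard (a', S') = Poly_Mapping.single m' 1" "\<And>v. Poly_Mapping.lookup m' (\<sigma> v) = vdeg M a' S' v"
    using standard_eq_single[OF S(2)] by blast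
  have "m = m'"
  proof -
    have "Poly_Mapping.keys (Poly_Mapping.single m (1::'k)) = Poly_Mapping.keys (Poly_Mapping.single m' (1::'k))"
      using eq m(1) m'(1) by simp
    then show ?thesis by simp
  qed
  then have "a i = a' i \<and> (i \<in> S \<longleftrightarrow> i \<in> S')" if "i \<le> M" for i
    using vdeg_inj[of S S' M a a' i] m(2) m'(2) sparseD[OF S(1)] sparseD[OF S(2)] that by simp
  moreover have "i \<le> M" if "i \<in> S \<union> S'" for i using that S by (auto simp: sparse_def)
  moreover have "a i = a' i" if "M < i" for i using that idx by (simp add: idx_def)
  ultimately show "a = a' \<and> S = S'" by (metis UnCI linorder_not_le ext subsetI subset_antisym)
qed

lemma finite_idx: "finite (idx D)"
proof (rule finite_subset)
  show "idx D \<subseteq> {a. \<forall>i. (i \<in> {..M} \<longrightarrow> a i \<in> {..D}) \<and> (i \<notin> {..M} \<longrightarrow> a i = 0)} \<times> Pow {1..<M}"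
  proof
    fix z assume z: "z \<in> idx D"
    obtain a S where aS: "z = (a, S)" by fastforce
    have "a i \<le> D" if "i \<le> M" for i
      using member_le_sum[of i "{..M}" a] z aS that by (auto simp: idx_def)
    then show "z \<in> {a. \<forall>i. (i \<in> {..M} \<longrightarrow> a i \<in> {..D}) \<and> (i \<notin> {..M} \<longrightarrow> a i = 0)} \<times> Pow {1..<M}"
      using z aS by (auto simp: idx_def sparse_def)
  qed
  show "finite ({a. \<forall>i. (i \<in> {..M} \<longrightarrow> a i \<in> {..D}) \<and> (i \<notin> {..M} \<longrightarrow> a i = 0)} \<times> Pow {1..<M})"
    by (intro finite_cartesian_product finite_set_of_finite_funs) auto
qed

subsection \<open>Linear independence by counting\<close>
lemma standard_in_span: "standard ` idx D \<subseteq> mpol.span (basis ` idx D)"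
proof clarify
  fix a S assume i: "(a, S) \<in> idx D"
  then have S: "sparse S" "S \<subseteq> {..M}" by (auto simp: idx_def sparse_def)
  define B where "B i = (if i \<in> S then replicate_mset (a i + 1) (2 * i + 1) else replicate_mset (a i) (2 * i))" for i
  have sums: "lprod (sum B I) = (\<Prod>i\<in>I. lprod (B i)) \<and> size (sum B I) = (\<Sum>i\<in>I. size (B i))
      \<and> set_mset (sum B I) = (\<Union>i\<in>I. set_mset (B i))" if "finite I" for I
    using that by (induction I) auto
  have "standard (a, S) = lprod (sum B {..M})"
    unfolding sums[OF finite_atMost, THEN conjunct1] standard_def prod.case
    by (rule prod.cong) (simp_all add: B_def)
  moreover have "set_mset (B i) \<subseteq> labels" if "i \<le> M" for i
    using S that by (auto simp: B_def labels_def sparse_def split: if_splits)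
  then have "set_mset (sum B {..M}) \<subseteq> labels"
    using sums[OF finite_atMost, of M] by blast
  moreover have "size (sum B {..M}) \<le> D"
  proof -
    have "size (sum B {..M}) = (\<Sum>i\<le>M. a i + of_bool (i \<in> S))"
      unfolding sums[OF finite_atMost, THEN conjunct2, THEN conjunct1]
      by (rule sum.cong) (simp_all add: B_def)
    also have "\<dots> = (\<Sum>i\<le>M. a i) + card S"
      using S(2) by (simp add: sum.distrib Int_absorb1)
    finally show ?thesis using i by (simp add: idx_def)
  qed
  ultimately show "standard (a, S) \<in> mpol.span (basis ` idx D)"
    using lprod_in_span[of "sum B {..M}"] mpol.span_mono[OF image_mono[OF idx_mono[of "size (sum B {..M})" D]]]
    by auto
qed

text \<open>The standard monomials are as many independent vectors in the span of the family \<open>basis\<close> as the family has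
indices. A repetition or a linear dependence would allow a smaller spanning set.\<close>
lemma basis_idx: "inj_on basis (idx D) \<and> mpol.independent (basis ` idx D)"
proof -
  have indep: "mpol.independent (standard ` idx D)"
  proof (rule mpol.independent_mono[OF independent_monomials])
    show "standard ` idx D \<subseteq> range (\<lambda>m. Poly_Mapping.single m 1)"
    proof
      fix p assume "p \<in> standard ` idx D"
      then obtain a S where "p = standard (a, S)" "sparse S" by (auto simp: idx_def)
      then show "p \<in> range (\<lambda>m. Poly_Mapping.single m 1)"
        using standard_eq_single[of S a] by (metis rangeI)
    qed
  qed
  have bound: "card (idx D) \<le> card T" if "finite T" "basis ` idx D \<subseteq> mpol.span T" for T
  proof -
    have "standard ` idx D \<subseteq> mpol.span T"
      using standard_in_span mpol.span_minimal[OF that(2) mpol.subspace_span] by blast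
    then have "card (standard ` idx D) \<le> card T"
      using mpol.independent_span_bound[OF that(1) indep] by blast
    then show ?thesis by (simp add: card_image[OF inj_on_standard])
  qed
  have card: "card (basis ` idx D) = card (idx D)"
    using bound[of "basis ` idx D"] card_image_le[OF finite_idx, of basis D] finite_idx
    by (simp add: mpol.span_superset le_antisym)
  have "mpol.independent (basis ` idx D)"
  proof
    assume "mpol.dependent (basis ` idx D)"
    then obtain p where p: "p \<in> basis ` idx D" "p \<in> mpol.span (basis ` idx D - {p})"
      by (auto simp: mpol.dependent_def)
    have "basis ` idx D \<subseteq> mpol.span (basis ` idx D - {p})"
    proof
      fix p' assume "p' \<in> basis ` idx D"
      then show "p' \<in> mpol.span (basis ` idx D - {p})"
        using p(2) by (cases "p' = p") (simp_all add: mpol.span_base)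
    qed
    then have "card (idx D) \<le> card (basis ` idx D - {p})"
      using bound finite_idx by simp
    also have "\<dots> < card (basis ` idx D)"
      using p(1) finite_idx by (intro card_Diff1_less) auto
    finally show False using card by simp
  qed
  then show ?thesis using eq_card_imp_inj_on[OF finite_idx card] by simp
qed


subsection \<open>Regularity in coordinates\<close>
definition indices :: "((nat \<Rightarrow> nat) \<times> nat set) set" where
  "indices = {(a, S). (\<forall>i>M. a i = 0) \<and> sparse S}"

lemma indices_eq: "indices = (\<Union>D. idx D)"
  by (auto simp: indices_def idx_def)

lemma inj_on_basis: "inj_on basis indices"
proof (rule inj_onI)
  fix z z' assume z: "z \<in> indices" "z' \<in> indices" and eq: "basis z = basis z'"
  then obtain D E where "z \<in> idx D" "z' \<in> idx E" by (auto simp: indices_eq)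
  then have "z \<in> idx (max D E)" "z' \<in> idx (max D E)"
    using idx_mono[of D "max D E"] idx_mono[of E "max D E"] by auto
  then show "z = z'" using basis_idx[of "max D E"] eq by (auto dest: inj_onD)
qed

lemma independent_basis: "mpol.independent (basis ` indices)"
proof -
  have "mpol.independent (\<Union> (range (\<lambda>D. basis ` idx D)))"
  proof (rule mpol.independent_Union_directed)
    fix B C assume "B \<in> range (\<lambda>D. basis ` idx D)" "C \<in> range (\<lambda>D. basis ` idx D)"
    then obtain D E where *: "B = basis ` idx D" "C = basis ` idx E" by auto
    then show "B \<subseteq> C \<or> C \<subseteq> B"
      using idx_mono[of D E] idx_mono[of E D] by (metis image_mono nat_le_linear)
  qed (use basis_idx in auto)
  then show ?thesis by (simp add: indices_eq image_UN)
qed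

text \<open>The toric ring, as a subalgebra of the polynomial ring on the vertices; that it is closed under
multiplication is part of the proof of \<open>regular_sequence_params\<close>.\<close>
definition R :: "('v, 'k) mpol set" where "R = mpol.span (basis ` indices)"

definition coord :: "('v, 'k) mpol \<Rightarrow> (nat \<Rightarrow> nat) \<times> nat set \<Rightarrow> 'k" where
  "coord z j = mpol.representation (basis ` indices) z (basis j)"

lemma coord_add: "y \<in> R \<Longrightarrow> z \<in> R \<Longrightarrow> coord (y + z) j = coord y j + coord z j"
  by (simp add: coord_def R_def mpol.representation_add[OF independent_basis])

lemma coord_scale: "z \<in> R \<Longrightarrow> coord (const c * z) j = c * coord z j"
  by (simp add: coord_def R_def mpol.representation_scale[OF independent_basis])

lemma coord_zero: "coord 0 j = 0"
  by (simp add: coord_def mpol.representation_zero)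

lemma coord_basis: "i \<in> indices \<Longrightarrow> j \<in> indices \<Longrightarrow> coord (basis i) j = of_bool (i = j)"
  using inj_onD[OF inj_on_basis, of i j]
  by (auto simp: coord_def mpol.representation_basis[OF independent_basis])

lemma indices_shift: "(a, S) \<in> indices \<Longrightarrow> i \<le> M \<Longrightarrow> (a(i := n), S) \<in> indices"
  by (auto simp: indices_def)

lemma basis_in_R: "j \<in> indices \<Longrightarrow> basis j \<in> R"
  by (simp add: R_def mpol.span_base)

text \<open>Multiplication by a parameter maps the basis injectively into itself, raising one exponent, so it shifts
coordinates.\<close>
lemma param_mult_R:
  assumes "i \<le> M" "z \<in> R"
  shows "param i * z \<in> R \<and> (\<forall>(a, S)\<in>indices. coord (param i * z) (a, S)
    = (if a i = 0 then 0 else coord z (a(i := a i - 1), S)))" (is "?P z")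
proof -
  have "z \<in> R \<and> ?P z" using assms(2) unfolding R_def
  proof (induction rule: mpol.span_induct_alt)
    case base
    then show ?case by (auto simp: mpol.span_zero coord_zero)
  next
    case (step c b y)
    then obtain a' S' where b: "b = basis (a', S')" "(a', S') \<in> indices" by auto
    let ?b' = "(a'(i := Suc (a' i)), S')"
    have pb: "param i * b = basis ?b'" using b basis_shift[OF assms(1)] by simp
    have b': "?b' \<in> indices" by (rule indices_shift[OF b(2) assms(1)])
    have y: "y \<in> R" using step by (simp add: R_def)
    have py: "param i * y \<in> R" using step by (simp add: R_def)
    have eq: "param i * (const c * b + y) = const c * basis ?b' + param i * y"
      by (simp add: pb[symmetric] algebra_simps)
    have in_R: "const c * basis ?b' \<in> R" "const c * b \<in> R"
      using basis_in_R b b' by (simp_all add: R_def mpol.span_scale)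
    show ?case
    proof (intro conjI ballI, goal_cases)
      case 1
      then show ?case using in_R y by (simp add: R_def mpol.span_add)
    next
      case 2
      then show ?case unfolding eq using in_R py by (simp add: R_def mpol.span_add)
    next
      case (3 z)
      obtain a S where z: "z = (a, S)" "(a, S) \<in> indices" using 3 by (metis surj_pair)
      have idx: "(a(i := a i - 1), S) \<in> indices" by (rule indices_shift[OF z(2) assms(1)])
      have "?b' = (a, S) \<longleftrightarrow> a i \<noteq> 0 \<and> (a', S') = (a(i := a i - 1), S)"
        by (auto simp: fun_eq_iff)
      then have "coord (basis ?b') (a, S) = (if a i = 0 then 0 else coord b (a(i := a i - 1), S))"
        using coord_basis[OF b' z(2)] coord_basis[OF b(2) idx] b(1) by simp
      moreover have "coord (param i * y) (a, S) = (if a i = 0 then 0 else coord y (a(i := a i - 1), S))"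
        using step z(2) by auto
      moreover have "coord (param i * (const c * b + y)) (a, S) = c * coord (basis ?b') (a, S) + coord (param i * y) (a, S)"
        unfolding eq coord_add[OF in_R(1) py] coord_scale[OF basis_in_R[OF b']] ..
      moreover have "coord (const c * b + y) j = c * coord b j + coord y j" for j
        using coord_add[OF in_R(2) y] coord_scale[of b c] basis_in_R[OF b(2)] b(1) by simp
      ultimately show ?case unfolding z(1) prod.case by simp
    qed
  qed
  then show ?thesis by simp
qed

text \<open>This lemma and \<open>ideal_gen_if_coord\<close> describe the ideal generated by the parameters with index in \<open>js\<close> as
the set of elements whose coordinates vanish at all exponents that are zero on \<open>js\<close>.\<close>
lemma coord_ideal_gen:
  assumes "z \<in> ideal_gen R (map param js)" "set js \<subseteq> {..M}"
  shows "z \<in> R \<and> (\<forall>(a, S)\<in>indices. (\<forall>j\<in>set js. a j = 0) \<longrightarrow> coord z (a, S) = 0)"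
  using assms
proof (induction js arbitrary: z)
  case Nil
  then show ?case by (auto simp: R_def mpol.span_zero coord_zero)
next
  case (Cons j js)
  then obtain r s where rs: "z = param j * r + s" "r \<in> R" "s \<in> ideal_gen R (map param js)" by auto
  have s: "s \<in> R" "\<And>a S. (a, S) \<in> indices \<Longrightarrow> \<forall>j\<in>set js. a j = 0 \<Longrightarrow> coord s (a, S) = 0"
    using Cons.IH[OF rs(3)] Cons.prems by auto
  have r: "param j * r \<in> R" "\<And>a S. (a, S) \<in> indices \<Longrightarrow> a j = 0 \<Longrightarrow> coord (param j * r) (a, S) = 0"
    using param_mult_R[OF _ rs(2), of j] Cons.prems by auto
  show ?case using r s by (auto simp: rs(1) coord_add) (simp add: R_def mpol.span_add)
qed

lemma R_scale: "r \<in> R \<Longrightarrow> const c * r \<in> R"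
  by (simp add: R_def mpol.span_scale)

lemma ideal_gen_if_coord:
  assumes z: "z \<in> R" and js: "set js \<subseteq> {..M}"
    and zero: "\<And>a S. (a, S) \<in> indices \<Longrightarrow> \<forall>j\<in>set js. a j = 0 \<Longrightarrow> coord z (a, S) = 0"
  shows "z \<in> ideal_gen R (map param js)"
proof -
  let ?I = "ideal_gen R (map param js)" and ?rep = "mpol.representation (basis ` indices) z"
  have R0: "0 \<in> R" by (simp add: R_def mpol.span_zero)
  have I_add: "u + v \<in> ?I" if "u \<in> ?I" "v \<in> ?I" for u v
    using that by (intro ideal_gen_add) (auto simp: R_def mpol.span_add)
  have "const (?rep b) * b \<in> ?I" if ne: "?rep b \<noteq> 0" for b
  proof -
    have "b \<in> basis ` indices" using that mpol.representation_ne_zero by blast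
    then obtain a S where b: "b = basis (a, S)" "(a, S) \<in> indices" by auto
    then obtain j where j: "j \<in> set js" "a j \<noteq> 0"
      using zero[of a S] ne unfolding coord_def by blast
    have jM: "j \<le> M" using j js by auto
    have "basis (a, S) = param j * basis (a(j := a j - 1), S)"
      using basis_shift[OF jM, of "a(j := a j - 1)" S] j by simp
    then have "const (?rep b) * b = param j * (const (?rep b) * basis (a(j := a j - 1), S))"
      using b by (simp add: mult_ac)
    also have "\<dots> \<in> ?I"
      using j indices_shift[OF b(2) jM] by (intro ideal_gen_base[OF R0] R_scale basis_in_R) auto
    finally show ?thesis .
  qed
  then have "(\<Sum>b\<in>F. const (?rep b) * b) \<in> ?I" if "F \<subseteq> {b. ?rep b \<noteq> 0}" for F
    using that
  proof (induction F rule: infinite_finite_induct)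
    case (insert b F)
    then show ?case using I_add by simp
  qed (simp_all add: ideal_gen_0[OF R0])
  moreover have "(\<Sum>b | ?rep b \<noteq> 0. const (?rep b) * b) = z"
    by (rule mpol.sum_nonzero_representation_eq[OF independent_basis z[unfolded R_def]])
  ultimately show ?thesis by force
qed

text \<open>Raising the exponent of \<open>X\<^sub>i\<close> does not change the exponents of \<open>X\<^sub>0, \<dots>, X\<^sub>i\<^sub>-\<^sub>1\<close>, so multiplication by \<open>X\<^sub>i\<close>
preserves the coordinates that decide membership in the ideal of the latter.\<close>
lemma param_regular:
  assumes i: "i \<le> M" and z: "z \<in> R" and mem: "param i * z \<in> ideal_gen R (map param [0..<i])"
  shows "z \<in> ideal_gen R (map param [0..<i])"
proof (rule ideal_gen_if_coord[OF z])
  show sub: "set [0..<i] \<subseteq> {..M}" using i by auto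
  fix a S assume aS: "(a, S) \<in> indices" "\<forall>j\<in>set [0..<i]. a j = 0"
  let ?a = "a(i := Suc (a i))"
  have idx: "(?a, S) \<in> indices" by (rule indices_shift[OF aS(1) i])
  have "coord z (a, S) = coord (param i * z) (?a, S)"
    using bspec[OF conjunct2[OF param_mult_R[OF i z]] idx] by simp
  also have "\<dots> = 0"
    using bspec[OF conjunct2[OF coord_ideal_gen[OF mem sub]] idx] aS(2) by simp
  finally show "coord z (a, S) = 0" .
qed

lemma param_proper: "1 \<notin> ideal_gen R (map param [0..<Suc M])"
proof
  assume "1 \<in> ideal_gen R (map param [0..<Suc M])"
  moreover have idx: "(\<lambda>_. 0, {}) \<in> indices" by (simp add: indices_def sparse_def)
  ultimately have "coord 1 (\<lambda>_. 0, {}) = 0"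
    using coord_ideal_gen[of 1 "[0..<Suc M]"] by fastforce
  moreover have "basis (\<lambda>_. 0, {}) = 1" by (simp add: basis_def)
  then have "coord 1 (\<lambda>_. 0, {}) = 1" using coord_basis[OF idx idx] by simp
  ultimately show False by simp
qed

lemma lprod_in_R: "set_mset A \<subseteq> labels \<Longrightarrow> lprod A \<in> R"
  using lprod_in_span[of A] mpol.span_mono[of "basis ` idx (size A)" "basis ` indices"]
  by (auto simp: R_def indices_eq)


text \<open>The homomorphism that sends each variable to its edge has image \<open>R\<close>: its values are combinations of
products of edges, and conversely every basis element is a polynomial in the edges.\<close>
lemma regular_sequence_params:
  assumes f: "\<And>l. l \<in> labels \<Longrightarrow> f l = x l"
  defines "S \<equiv> mpol_ring labels :: (nat, 'k) mpol ring"
  defines "I \<equiv> a_kernel S (mpol_ring UNIV) (subst_hom f)"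
  shows "regular_sequence (S Quot I) (map ((+>\<^bsub>S\<^esub>) I)
    (map (\<lambda>i. if i = 0 \<or> i = M then var (2 * i) else var (2 * i) - var (2 * i + 1)) [0..<Suc M]))"
  (is "regular_sequence _ (map _ (map ?X _))")
proof -
  interpret P: toric_presentation labels f .
  have even: "2 * i \<in> labels" if "i \<le> M" for i using that by (simp add: labels_def)
  have odd: "2 * i + 1 \<in> labels" if "i \<noteq> 0" "i < M" for i using that by (simp add: labels_def)
  have hX: "subst_hom f (?X i) = param i" if "i \<le> M" for i
  proof (cases "i = 0 \<or> i = M")
    case True
    then show ?thesis using f[OF even[OF that]] by (auto simp: param_def subst_hom_var)
  next
    case False
    then show ?thesis
      using f[OF even[OF that]] f[OF odd[of i]] that
      by (simp add: param_def subst_hom_var subst_hom_diff)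
  qed
  have X: "?X i \<in> carrier (mpol_ring labels)" if "i \<le> M" for i
    using even[OF that] odd[of i] that
    by (auto intro!: carrier_mpol_ring_var carrier_mpol_ring_diff)
  have A: "P.A = R"
  proof
    have monom: "monom_value f m \<in> R" if "Poly_Mapping.keys m \<subseteq> labels" for m
    proof -
      have sums: "lprod (\<Sum>l\<in>L. replicate_mset (Poly_Mapping.lookup m l) l) = (\<Prod>l\<in>L. f l ^ Poly_Mapping.lookup m l)
        \<and> set_mset (\<Sum>l\<in>L. replicate_mset (Poly_Mapping.lookup m l) l) \<subseteq> L"
        if "finite L" "L \<subseteq> labels" for L
        using that by (induction L) (auto simp: f split: if_splits)
      then show ?thesis
        using sums[OF finite_keys that] lprod_in_R that unfolding monom_value_def by (metis order_trans)
    qed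
    show "P.A \<subseteq> R"
    proof clarify
      fix p :: "(nat, 'k) mpol" assume "p \<in> carrier (mpol_ring labels)"
      then show "subst_hom f p \<in> R"
        unfolding subst_hom_alt in_carrier_mpol_ring using monom
        by (auto simp: R_def intro!: mpol.span_sum mpol.span_scale)
    qed
    have power: "u ^ n \<in> P.A" if "u \<in> P.A" for u n
      using that by (induction n) (auto intro: P.A_closed)
    have prod: "prod g L \<in> P.A" if "\<And>l. l \<in> L \<Longrightarrow> g l \<in> P.A" for g and L :: "nat set"
      using that by (induction L rule: infinite_finite_induct) (auto intro: P.A_closed)
    have gens: "param i \<in> P.A" "x (2 * i) \<in> P.A" if "i \<le> M" for i
    proof -
      show "param i \<in> P.A" unfolding hX[OF that, symmetric] by (rule imageI[OF X[OF that]])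
      show "x (2 * i) \<in> P.A"
        by (rule image_eqI[OF _ carrier_mpol_ring_var[OF even[OF that]]])
          (simp only: subst_hom_var f[OF even[OF that]])
    qed
    have "basis (a, T) \<in> P.A" if "(a, T) \<in> indices" for a T
    proof -
      have "T \<subseteq> {..M}" using that by (auto simp: indices_def sparse_def)
      then show ?thesis
        unfolding basis_def prod.case by (intro P.A_closed(4) prod power gens) auto
    qed
    moreover have "mpol.subspace P.A"
    proof (rule mpol.subspaceI)
      show "0 \<in> P.A" by (rule P.A_closed)
      show "u + v \<in> P.A" if "u \<in> P.A" "v \<in> P.A" for u v using that by (rule P.A_closed)
    next
      fix c u assume "u \<in> P.A"
      moreover have "subst_hom f (const c) = const c"
        using subst_hom_single[of f 0 c] by (simp add: const_def)
      then have "const c \<in> P.A" using imageI[OF carrier_mpol_ring_const[of c labels], of "subst_hom f"] by simp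
      ultimately show "const c * u \<in> P.A" by (rule P.A_closed(4)[rotated])
    qed
    ultimately show "R \<subseteq> P.A"
      unfolding R_def by (intro mpol.span_minimal) auto
  qed
  have map_X: "map (subst_hom f) (map ?X [0..<i]) = map param [0..<i]" if "i \<le> Suc M" for i
    using hX that by auto
  show ?thesis
    unfolding S_def I_def
  proof (rule P.regular_sequenceI)
    show "set (map ?X [0..<Suc M]) \<subseteq> carrier (mpol_ring labels)"
    proof (unfold set_map, rule image_subsetI)
      fix i assume "i \<in> set [0..<Suc M]"
      then have "i \<le> M" by auto
      then show "?X i \<in> carrier (mpol_ring labels)" by (rule X)
    qed
    show "1 \<notin> ideal_gen P.A (map (subst_hom f) (map ?X [0..<Suc M]))"
      unfolding A map_X[OF order_refl] by (rule param_proper)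
    fix i b assume i: "i < length (map ?X [0..<Suc M])" and b: "b \<in> P.A"
      and mem: "subst_hom f (map ?X [0..<Suc M] ! i) * b \<in> ideal_gen P.A (map (subst_hom f) (take i (map ?X [0..<Suc M])))"
    have i': "i \<le> M" "i \<le> Suc M" using i by simp_all
    have take: "take i (map ?X [0..<Suc M]) = map ?X [0..<i]"
      using i' by (simp only: take_map take_upt add_0 length_upt)
    have nth: "map ?X [0..<Suc M] ! i = ?X i" using i by (simp only: nth_map length_map nth_upt length_upt) simp
    show "b \<in> ideal_gen P.A (map (subst_hom f) (take i (map ?X [0..<Suc M])))"
      using b mem unfolding take nth A hX[OF i'(1)] map_X[OF i'(2)]
      by (rule param_regular[OF i'(1)])
  qed
qed

end

section \<open>The graph of a ladder\<close>

text \<open>The vertices in the order in which the ladder acquires them: columns are even, rows are odd.\<close>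
definition vertex :: "nat \<Rightarrow> nat + nat" where
  "vertex k = (if even k then Inr (k div 2 + 1) else Inl (k div 2 + 1))"

text \<open>The older end of the edge \<open>x\<^sub>2\<^sub>i\<^sub>+\<^sub>1\<close>, whose younger end is the vertex \<open>i + 2\<close>. The bit that decides about the
vertex \<open>i + 2\<close> is \<open>t\<^sub>i\<close>, which is \<open>t ! (i - 1)\<close>. The value at \<open>0\<close> is arbitrary, as there is no \<open>x\<^sub>1\<close>.\<close>
fun rung :: "bit list \<Rightarrow> nat \<Rightarrow> nat" where
  "rung t 0 = 0"
| "rung t (Suc 0) = 0"
| "rung t (Suc (Suc 0)) = 1"
| "rung t (Suc (Suc (Suc i))) = (if t ! (i + 2) = 0 then rung t (Suc i) else i + 2)"

definition top_end :: "nat \<Rightarrow> nat" where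
  "top_end l = (if even l then l div 2 + 1 else l div 2 + 2)"

definition bottom_end :: "bit list \<Rightarrow> nat \<Rightarrow> nat" where
  "bottom_end t l = (if even l then l div 2 else rung t (l div 2))"

text \<open>The position of an edge between vertices of different parity.\<close>
definition cell :: "nat \<Rightarrow> nat \<Rightarrow> nat \<times> nat" where
  "cell u v = (if odd u then (u div 2 + 1, v div 2 + 1) else (v div 2 + 1, u div 2 + 1))"

lemma inj_vertex: "inj vertex"
proof (rule injI)
  fix k l assume "vertex k = vertex l"
  then have "even k = even l" "k div 2 = l div 2" by (auto simp: vertex_def split: if_splits)
  then show "k = l" by (metis bit_eq_rec mod2_eq_if)
qed

lemma rung_less: "i \<noteq> 0 \<Longrightarrow> rung t i < i"
  by (induction t i rule: rung.induct) auto

lemma odd_rung: "i \<noteq> 0 \<Longrightarrow> odd (i + rung t i)"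
  by (induction t i rule: rung.induct) auto

lemma rung_butlast: "i < length t \<Longrightarrow> rung (butlast t) i = rung t i"
  by (induction t i rule: rung.induct) (auto simp: nth_butlast)

lemma rung_at:
  assumes "2 \<le> m"
  shows "rung t (Suc m) = (if t ! m = 0 then rung t (m - 1) else m)"
proof -
  obtain i where "m = Suc (Suc i)" using assms by (metis One_nat_def add_2_eq_Suc le_Suc_ex)
  then show ?thesis by simp
qed

definition ladder_labels :: "nat \<Rightarrow> nat set" where "ladder_labels n = {..2 * n + 4} - {1}"

lemma ends_less: "l \<noteq> 1 \<Longrightarrow> bottom_end t l < top_end l"
  using rung_less[of "l div 2" t] by (auto simp: bottom_end_def top_end_def elim: oddE)

lemma ends_parity: "l \<noteq> 1 \<Longrightarrow> odd (top_end l + bottom_end t l)"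
  using odd_rung[of "l div 2" t] by (auto simp: bottom_end_def top_end_def elim!: oddE)

lemma cell_vertices:
  assumes "odd (u + v)" "cell u v = (i, j)"
  shows "{Inl i, Inr j} = {vertex u, vertex v}"
  using assms by (auto simp: cell_def vertex_def split: if_splits)

lemma cell_eq_iff:
  assumes "odd (u + v)" "odd (u' + v')" "v < u" "v' < u'"
  shows "cell u v = cell u' v' \<longleftrightarrow> u = u' \<and> v = v'"
proof
  assume eq: "cell u v = cell u' v'"
  obtain i j where ij: "cell u v = (i, j)" by fastforce
  have "{vertex u, vertex v} = {vertex u', vertex v'}"
    using cell_vertices[OF assms(1) ij] cell_vertices[OF assms(2) ij[unfolded eq]] by simp
  then have "(u = u' \<and> v = v') \<or> (u = v' \<and> v = u')"
    by (simp add: doubleton_eq_iff inj_eq[OF inj_vertex])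
  then show "u = u' \<and> v = v'" using assms(3,4) by auto
qed simp

text \<open>The row or column that receives the rung has exactly three entries, and the largest position belongs to the
newest one, which is never chosen.\<close>
lemma pick_three:
  assumes "a < b" "b < (c::nat)"
  shows "pick s {a, b, c} = (if s = 0 then a else b)"
proof -
  have "Min {a, b, c} = a" using assms by (intro Min_eqI) auto
  moreover have "{a, b, c} - {a} = {b, c}" using assms by auto
  moreover have "Min {b, c} = b" using assms by (intro Min_eqI) auto
  ultimately show ?thesis by (simp add: pick_def)
qed

text \<open>Passing from \<open>n\<close> to \<open>n + 1\<close> adds the vertex \<open>n + 4\<close> and two edges at it. Both positions lie in the new row or
column, hence no older entry is overwritten.\<close>
lemma ladder_extend:
  assumes A: "\<And>p l. A p = Some l \<longleftrightarrow> l \<in> ladder_labels n \<and> p = cell (top_end l) (bottom_end t l)"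
    and m: "v = rung t (n + 2)"
  shows "(A(cell (n + 4) (n + 3) \<mapsto> 2 * n + 6, cell (n + 4) v \<mapsto> 2 * n + 5)) p = Some l
    \<longleftrightarrow> l \<in> ladder_labels (Suc n) \<and> p = cell (top_end l) (bottom_end t l)"
proof -
  have v: "v < n + 2" "odd (n + 2 + v)"
    unfolding m using rung_less[of "n + 2" t] odd_rung[of "n + 2" t] by simp_all
  have new: "A (cell (n + 4) u) = None" if "u < n + 4" "odd (n + 4 + u)" for u
  proof (rule ccontr)
    assume "A (cell (n + 4) u) \<noteq> None"
    then obtain l where l: "l \<in> ladder_labels n" "cell (n + 4) u = cell (top_end l) (bottom_end t l)"
      using A by auto
    then have "l \<noteq> 1" by (simp add: ladder_labels_def)
    then have "top_end l = n + 4"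
      using l(2) cell_eq_iff[OF that(2) ends_parity that(1) ends_less] by simp
    then show False using l(1) by (auto simp: top_end_def ladder_labels_def split: if_splits elim!: oddE)
  qed
  have ends: "top_end (2 * n + 6) = n + 4" "bottom_end t (2 * n + 6) = n + 3"
    "top_end (2 * n + 5) = n + 4" "bottom_end t (2 * n + 5) = v"
    by (simp_all add: top_end_def bottom_end_def m)
  have neq: "cell (n + 4) v \<noteq> cell (n + 4) (n + 3)"
    using cell_eq_iff[of "n + 4" v "n + 4" "n + 3"] v by simp
  have labels: "l \<in> ladder_labels (Suc n) \<longleftrightarrow> l \<in> ladder_labels n \<or> l = 2 * n + 6 \<or> l = 2 * n + 5" for l
    by (auto simp: ladder_labels_def)
  have old: "2 * n + 6 \<notin> ladder_labels n" "2 * n + 5 \<notin> ladder_labels n"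
    by (simp_all add: ladder_labels_def)
  consider "p = cell (n + 4) v" | "p = cell (n + 4) (n + 3)" | "p \<noteq> cell (n + 4) v" "p \<noteq> cell (n + 4) (n + 3)"
    by blast
  then show ?thesis
  proof cases
    case 1
    then have "\<not> (l \<in> ladder_labels n \<and> p = cell (top_end l) (bottom_end t l))"
      using A[of p l] new[of v] v by simp
    then show ?thesis using 1 ends neq labels by auto
  next
    case 2
    then have "\<not> (l \<in> ladder_labels n \<and> p = cell (top_end l) (bottom_end t l))"
      using A[of p l] new[of "n + 3"] by simp
    then show ?thesis using 2 ends neq labels by auto
  next
    case 3
    then show ?thesis using A[of p l] ends labels old by auto
  qed
qed

text \<open>The vertex \<open>n + 2\<close> is the row or column in which the next rung is chosen. Its neighbours are the two older
vertices to which it was joined when it was added and the vertex \<open>n + 3\<close> that came next.\<close>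
lemma ladder_neighbours:
  assumes A: "\<And>p l. A p = Some l \<longleftrightarrow> l \<in> ladder_labels n \<and> p = cell (top_end l) (bottom_end t l)"
    and n: "1 \<le> n" and v: "odd (n + 2 + v)"
  shows "cell (n + 2) v \<in> dom A \<longleftrightarrow> v \<in> {rung t n, n + 1, n + 3}"
proof -
  have cell_swap: "cell u v = cell v u" if "odd (u + v)" for u v
    using that by (auto simp: cell_def)
  have key: "cell (n + 2) v = cell (top_end l) (bottom_end t l)
      \<longleftrightarrow> (top_end l = n + 2 \<and> bottom_end t l = v) \<or> (top_end l = v \<and> bottom_end t l = n + 2)"
    if "l \<noteq> 1" for l
  proof (cases "v < n + 2")
    case True
    then show ?thesis using cell_eq_iff[OF v ends_parity[OF that] True ends_less[OF that]] ends_less[OF that, of t] by auto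
  next
    case False
    then have lt: "n + 2 < v" using v by (cases "v = n + 2") auto
    have v': "odd (v + (n + 2))" using v by (simp add: add.commute)
    show ?thesis
      using cell_eq_iff[OF v' ends_parity[OF that] lt ends_less[OF that], of t] ends_less[OF that, of t] lt
        cell_swap[OF v] by auto
  qed
  show ?thesis
  proof
    assume "cell (n + 2) v \<in> dom A"
    then obtain l where "A (cell (n + 2) v) = Some l" by blast
    then have l: "l \<in> ladder_labels n" "cell (n + 2) v = cell (top_end l) (bottom_end t l)"
      by (simp_all add: A)
    then have l1: "l \<noteq> 1" by (simp add: ladder_labels_def)
    from l(2) key[OF l1] consider "top_end l = n + 2" "bottom_end t l = v" | "top_end l = v" "bottom_end t l = n + 2"
      by blast
    then show "v \<in> {rung t n, n + 1, n + 3}"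
    proof cases
      case 1
      then show ?thesis by (auto simp: top_end_def bottom_end_def split: if_splits elim!: oddE evenE)
    next
      case 2
      have "even l"
      proof (rule ccontr)
        assume "odd l"
        then have "rung t (l div 2) = n + 2" using 2 by (simp add: bottom_end_def)
        moreover have "l div 2 \<noteq> 0" using \<open>odd l\<close> l1 by (auto elim!: oddE)
        ultimately have "n + 2 < l div 2" using rung_less[of "l div 2" t] by simp
        then show False using l(1) \<open>odd l\<close> by (auto simp: ladder_labels_def)
      qed
      then show ?thesis using 2 by (auto simp: top_end_def bottom_end_def)
    qed
  next
    have *: "cell (n + 2) v \<in> dom A" if "l \<in> ladder_labels n"
      "(top_end l = n + 2 \<and> bottom_end t l = v) \<or> (top_end l = v \<and> bottom_end t l = n + 2)" for l
      using that key[of l] A[of "cell (n + 2) v" l] by (auto simp: ladder_labels_def)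
    assume "v \<in> {rung t n, n + 1, n + 3}"
    then consider "v = rung t n" | "v = n + 1" | "v = n + 3" by blast
    then show "cell (n + 2) v \<in> dom A"
    proof cases
      case 1
      then show ?thesis using n by (intro *[of "2 * n + 1"]) (auto simp: ladder_labels_def top_end_def bottom_end_def)
    next
      case 2
      then show ?thesis by (intro *[of "2 * n + 2"]) (auto simp: ladder_labels_def top_end_def bottom_end_def)
    next
      case 3
      then show ?thesis by (intro *[of "2 * n + 4"]) (auto simp: ladder_labels_def top_end_def bottom_end_def)
    qed
  qed
qed

text \<open>In the recursion, the three neighbours of the vertex \<open>m + 3\<close> in increasing order are \<open>rung t (m + 1)\<close>,
\<open>m + 2\<close> and \<open>m + 4\<close>. Choosing the first or the second entry is therefore the case distinction in the definition
of \<open>rung\<close>. Rows and columns swap roles with the parity of \<open>m\<close>.\<close>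
lemma ladder_iff:
  assumes "length t = n + 1"
  shows "ladder n t p = Some l \<longleftrightarrow> l \<in> ladder_labels n \<and> p = cell (top_end l) (bottom_end t l)"
  using assms
proof (induction n t arbitrary: p l rule: ladder.induct)
  case (1 t)
  have labels: "ladder_labels 0 = {0, 2, 3, 4}" by (auto simp: ladder_labels_def)
  have cells: "cell (top_end 0) (bottom_end t 0) = (1, 1)" "cell (top_end 2) (bottom_end t 2) = (1, 2)"
    "cell (top_end 3) (bottom_end t 3) = (2, 1)" "cell (top_end 4) (bottom_end t 4) = (2, 2)"
    by (simp_all add: top_end_def bottom_end_def cell_def)
  have *: "l \<in> ladder_labels 0 \<and> p = cell (top_end l) (bottom_end t l) \<longleftrightarrow>
      (p, l) \<in> {((1, 1), 0), ((1, 2), 2), ((2, 1), 3), ((2, 2), 4)}"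
    unfolding labels insert_iff empty_iff using cells by auto
  show ?case
  proof (cases "p \<in> {(1, 1), (1, 2), (2, 1), (2, 2)}")
    case True
    then show ?thesis unfolding * by (elim insertE emptyE) auto
  next
    case False
    then show ?thesis unfolding * by auto
  qed
next
  case (2 t)
  have labels: "ladder_labels (Suc 0) = {0, 2, 3, 4, 5, 6}" by (auto simp: ladder_labels_def)
  have "rung t 2 = 1" by (simp add: numeral_2_eq_2)
  then have cells: "cell (top_end 0) (bottom_end t 0) = (1, 1)" "cell (top_end 2) (bottom_end t 2) = (1, 2)"
    "cell (top_end 3) (bottom_end t 3) = (2, 1)" "cell (top_end 4) (bottom_end t 4) = (2, 2)"
    "cell (top_end 5) (bottom_end t 5) = (1, 3)" "cell (top_end 6) (bottom_end t 6) = (2, 3)"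
    by (simp_all add: top_end_def bottom_end_def cell_def)
  have *: "l \<in> ladder_labels (Suc 0) \<and> p = cell (top_end l) (bottom_end t l) \<longleftrightarrow>
      (p, l) \<in> {((1, 1), 0), ((1, 2), 2), ((1, 3), 5), ((2, 1), 3), ((2, 2), 4), ((2, 3), 6)}"
    unfolding labels insert_iff empty_iff using cells by auto
  show ?case
  proof (cases "p \<in> {(1, 1), (1, 2), (1, 3), (2, 1), (2, 2), (2, 3)}")
    case True
    then show ?thesis unfolding * by (elim insertE emptyE) auto
  next
    case False
    then show ?thesis unfolding * by auto
  qed
next
  case (3 m t)
  define A where "A = ladder (Suc m) (butlast t)"
  have step: "ladder (Suc (Suc m)) t =
     (let n = m + 2; r = nrows n; c = ncols n
      in if even n
         then A((r, c) \<mapsto> 2 * n + 4, (r, pick (last t) {j. (r - 1, j) \<in> dom A}) \<mapsto> 2 * n + 3)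
         else A((r, c) \<mapsto> 2 * n + 4, (pick (last t) {i. (i, c - 1) \<in> dom A}, c) \<mapsto> 2 * n + 3))"
    by (simp only: ladder.simps A_def Let_def)
  have "rung (butlast t) i = rung t i" if "i \<le> m + 2" for i
    using that 3 by (intro rung_butlast) simp
  then have "bottom_end (butlast t) l = bottom_end t l" if "l \<in> ladder_labels (Suc m)" for l
    using that by (auto simp: bottom_end_def ladder_labels_def elim!: oddE)
  then have A_iff: "A p = Some l \<longleftrightarrow> l \<in> ladder_labels (Suc m) \<and> p = cell (top_end l) (bottom_end t l)" for p l
    using "3.IH"[of "m + 2"] 3 by (auto simp: A_def)
  have last: "last t = t ! (m + 2)" using 3 by (subst last_conv_nth) auto
  let ?v = "rung t (m + 3)"
  have v: "?v = (if last t = 0 then rung t (m + 1) else m + 2)"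
    using rung_at[of "m + 2" t] last by (simp add: numeral_3_eq_3)
  have lt: "rung t (m + 1) < m + 1" "odd (m + 1 + rung t (m + 1))"
    using rung_less[of "m + 1" t] odd_rung[of "m + 1" t] by simp_all
  have nb: "cell (m + 3) u \<in> dom A \<longleftrightarrow> u \<in> {rung t (m + 1), m + 2, m + 4}" if "odd (m + 3 + u)" for u
    using ladder_neighbours[of A "Suc m" t u] A_iff that by (simp add: eval_nat_numeral)
  have "ladder (Suc (Suc m)) t = A(cell (m + 5) (m + 4) \<mapsto> 2 * m + 8, cell (m + 5) ?v \<mapsto> 2 * m + 7)"
  proof (cases "even m")
    case True
    then obtain k where k: "m = 2 * k" by auto
    obtain w where w: "rung t (m + 1) = 2 * w" using lt True by (auto elim!: evenE)
    have "{j. (k + 2, j) \<in> dom A} = {w + 1, k + 2, k + 3}"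
    proof -
      have "(k + 2, j) \<in> dom A \<longleftrightarrow> j \<in> {w + 1, k + 2, k + 3}" for j
      proof (cases j)
        case 0
        have "(k + 2, 0) \<noteq> cell u u'" for u u' by (simp add: cell_def)
        then show ?thesis using 0 A_iff by (auto simp: dom_def)
      next
        case (Suc j')
        then have pos: "(k + 2, j) = cell (m + 3) (2 * j')" by (simp add: cell_def k)
        have "cell (m + 3) (2 * j') \<in> dom A \<longleftrightarrow> 2 * j' \<in> {2 * w, m + 2, m + 4}"
          unfolding w[symmetric] by (rule nb) (use True in simp)
        then show ?thesis unfolding pos using Suc k by auto
      qed
      then show ?thesis by blast
    qed
    moreover have "w < k + 1" using lt w k by simp
    ultimately have "pick (last t) {j. (k + 2, j) \<in> dom A} = ?v div 2 + 1"
      using v w k by (simp add: pick_three)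
    then show ?thesis using k unfolding step
      by (simp add: Let_def cell_def nrows_def ncols_def add.commute)
  next
    case False
    then obtain k where k: "m = 2 * k + 1" by (auto elim!: oddE)
    obtain w where w: "rung t (m + 1) = 2 * w + 1" using lt False by (auto elim!: oddE)
    have "{i. (i, k + 3) \<in> dom A} = {w + 1, k + 2, k + 3}"
    proof -
      have "(i, k + 3) \<in> dom A \<longleftrightarrow> i \<in> {w + 1, k + 2, k + 3}" for i
      proof (cases i)
        case 0
        have "(0, k + 3) \<noteq> cell u u'" for u u' by (simp add: cell_def)
        then show ?thesis using 0 A_iff by (auto simp: dom_def)
      next
        case (Suc i')
        then have pos: "(i, k + 3) = cell (m + 3) (2 * i' + 1)" by (simp add: cell_def k)
        have "cell (m + 3) (2 * i' + 1) \<in> dom A \<longleftrightarrow> 2 * i' + 1 \<in> {2 * w + 1, m + 2, m + 4}"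
          unfolding w[symmetric] by (rule nb) (use False in simp)
        then show ?thesis unfolding pos using Suc k by auto
      qed
      then show ?thesis by blast
    qed
    moreover have "w < k + 1" using lt w k by simp
    ultimately have pick: "pick (last t) {i. (i, k + 3) \<in> dom A} = ?v div 2 + 1"
      using v w k by (simp add: pick_three)
    have "nrows (m + 2) = k + 3" "ncols (m + 2) = k + 4" "k + 4 - 1 = k + 3" "odd (m + 2)"
      "2 * (m + 2) + 4 = 2 * m + 8" "2 * (m + 2) + 3 = 2 * m + 7"
      "cell (m + 5) (m + 4) = (k + 3, k + 4)" "cell (m + 5) ?v = (?v div 2 + 1, k + 4)"
      by (simp_all add: k nrows_def ncols_def cell_def)
    then show ?thesis unfolding step Let_def by (simp only: pick if_False)
  qed
  then show ?case
    using ladder_extend[of A "Suc m" t ?v p l] A_iff by (simp add: eval_nat_numeral)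
qed

lemma edges_graph_of_ladder:
  assumes "length t = n + 1"
  shows "edges (graph_of_ladder n t) = ladder_labels n"
  by (auto simp: graph_of_ladder_def ran_def ladder_iff[OF assms])

lemma ends_graph_of_ladder:
  assumes t: "length t = n + 1" and l: "l \<in> ladder_labels n"
  shows "ends (graph_of_ladder n t) l = {vertex (top_end l), vertex (bottom_end t l)}"
proof -
  obtain i j where ij: "cell (top_end l) (bottom_end t l) = (i, j)" by fastforce
  have "l \<noteq> 1" using l by (simp add: ladder_labels_def)
  then have "{Inl i, Inr j} = {vertex (top_end l), vertex (bottom_end t l)}"
    using cell_vertices[OF ends_parity ij] by simp
  moreover have "ends (graph_of_ladder n t) l = {Inl i, Inr j}"
    using l ij by (auto simp: graph_of_ladder_def ladder_iff[OF t])
  ultimately show ?thesis by simp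
qed

theorem corollary3p12:
  fixes n :: nat and t :: "bit list"
  assumes "length t = n + 1"
  shows "regular_sequence
           (toric_ring (graph_of_ladder n t) :: (nat, 'k::field) mpol set ring)
           (map (toric_class (graph_of_ladder n t)) (ladder_seq n))"
proof -
  let ?G = "graph_of_ladder n t"
  let ?f = "\<lambda>e. \<Prod>v\<in>ends ?G e. var v :: (nat + nat, 'k) mpol"
  define x where "x l = var (vertex (top_end l)) * (var (vertex (bottom_end t l)) :: (nat + nat, 'k) mpol)" for l
  interpret ladder_monomials "n + 2" "rung t" vertex x
  proof
    show "rung t 2 = 1" by (simp add: numeral_2_eq_2)
    show "rung t i = i - 1 \<or> rung t i = rung t (i - 2)" if "3 \<le> i" for i
      using rung_at[of "i - 1" t] that by (auto simp: Suc_diff_Suc numeral_2_eq_2)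
  qed (simp_all add: inj_vertex x_def top_end_def bottom_end_def)
  have labels: "labels = ladder_labels n" unfolding labels_def ladder_labels_def by auto
  have f: "?f l = x l" if "l \<in> labels" for l
  proof -
    have l: "l \<in> ladder_labels n" using that labels by simp
    then have "bottom_end t l < top_end l" by (intro ends_less) (simp add: ladder_labels_def)
    then have "vertex (top_end l) \<noteq> vertex (bottom_end t l)" by (simp add: inj_eq[OF inj_vertex])
    then show ?thesis by (simp add: ends_graph_of_ladder[OF assms l] x_def)
  qed
  have seq: "ladder_seq n = map (\<lambda>i. if i = 0 \<or> i = n + 2 then var (2 * i) else var (2 * i) - var (2 * i + 1)) [0..<Suc (n + 2)]"
    (is "_ = map ?X _")
  proof -
    have "[0..<Suc (n + 2)] = 0 # [1..<n + 2] @ [n + 2]" by (simp add: upt_conv_Cons)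
    moreover have "map ?X [1..<n + 2] = map (\<lambda>i. var (2 * i) - var (2 * i + 1)) [1..<n + 2]" by auto
    moreover have "2 * (n + 2) = 2 * n + 4" by simp
    then have "?X 0 = var 0" "?X (n + 2) = var (2 * n + 4)" by (simp_all only: mult_0_right simp_thms if_True)
    ultimately show ?thesis by (simp only: ladder_seq_def list.map map_append append.simps)
  qed
  have edge: "edge_ring ?G = mpol_ring labels"
    unfolding edge_ring_def edges_graph_of_ladder[OF assms] labels ..
  have ideal: "toric_ideal ?G = a_kernel (mpol_ring labels) (mpol_ring UNIV) (subst_hom ?f)"
    by (simp add: toric_ideal_def edge toric_hom_def vertex_ring_def a_kernel_def')
  have cls: "toric_class ?G = (+>\<^bsub>mpol_ring labels\<^esub>) (a_kernel (mpol_ring labels) (mpol_ring UNIV) (subst_hom ?f))"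
    by (rule ext) (simp add: toric_class_def edge ideal)
  show ?thesis
    unfolding toric_ring_def cls edge ideal seq by (rule regular_sequence_params[OF f])
qed

end
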